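(* Let $\mathcal{H}$ be a real Hilbert space and let $f:\mathcal{H}\to\mathbb{R}\cup\{+\infty\}$ be a convex, lower semicontinuous and proper function such that $S=\operatorname{argmin} f\neq\emptyset$. Let $x^*$ be the element of minimum norm of $S$. Let $0<r<1$, $\alpha>1$, and $t_0>0$. Let $x:[t_0,+\infty[\to\mathcal{H}$ be a solution trajectory, in the generalized sense given in the context, of $$\ddot x(t)+\left(\frac{\alpha}{t}+\frac{2^r(\alpha-1)^{r-1}}{t^{2r-1}}\right)\dot x(t)+\partial f\left(x(t)+\frac{t}{\alpha-1}\dot x(t)\right)+\frac{2^r(\alpha-1)^r}{t^{2r}}\,x(t)\ni 0,$$ which satisfies the initial conditions $x(t_0)\in\operatorname{dom} f$ and $\dot x(t_0)=0$. Then the following properties are satisfied: (i) $f(x(t))-\min_{\mathcal{H}} f=\mathcal{O}\left(\frac{1}{t^{\alpha-1}}+\frac{1}{t^{2r}}\right)$ as $t\to+\infty$; (ii) $x(t)$ converges strongly (in norm) to the minimum norm solution $x^*$ as $t\to+\infty$.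
   Context: $\partial f$ is the convex subdifferential and $\operatorname{dom} f=\{f<+\infty\}$. The second-order inclusion is understood in the following generalized sense: there is a function $v:[t_0,+\infty[\to\mathcal{H}$ such that $(v,x)$ is a strong solution of the first-order system $$\dot v(t)+\frac{t}{\alpha-1}\partial f(v(t))+\frac{2^r(\alpha-1)^{r-1}}{t^{2r-1}}v(t)\ni 0,\qquad \dot x(t)+\frac{\alpha-1}{t}\,(x(t)-v(t))=0,$$ which is the system $\dot v(t)+\frac{t}{\alpha-1}\partial f(v(t))+\frac{t}{\alpha-1}\varepsilon\left(\frac{t^2}{2(\alpha-1)}\right)v(t)\ni0$, $\dot x(t)+\frac{\alpha-1}{t}(x(t)-v(t))=0$ with $\varepsilon(t)=1/t^r$. The initial conditions $x(t_0)=x_0\in\operatorname{dom} f$, $\dot x(t_0)=0$ mean $v(t_0)=x(t_0)=x_0\in\operatorname{dom} f$. Strong solution (in the sense of Brezis): $(v,x)$ is continuous on $[t_0,+\infty[$, absolutely continuous on compact intervals, and satisfies the system for almost every $t\geq t_0$. $\mathcal{O}(g(t))$ means bounded by a constant times $g(t)$ for $t$ large. *)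

theory Defs
  imports "HOL-Analysis.Analysis"
begin

definition proper_fun :: "('a \<Rightarrow> ereal) \<Rightarrow> bool" where
  "proper_fun f \<longleftrightarrow> (\<forall>x. f x \<noteq> -\<infinity>) \<and> (\<exists>x. f x \<noteq> \<infinity>)"

definition effective_domain :: "('a \<Rightarrow> ereal) \<Rightarrow> 'a set" where
  "effective_domain f = {x. f x < \<infinity>}"

(* Intended for functions that avoid the value -\<infinity>, so that the sum on the right-hand side is
   never of the form \<infinity> - \<infinity>; at the endpoints u = 0 and v = 0 the convention 0 * \<infinity> = 0 applies. *)
definition convex_fun :: "('a::real_vector \<Rightarrow> ereal) \<Rightarrow> bool" where
  "convex_fun f \<longleftrightarrow>
     (\<forall>x y u v. 0 \<le> u \<longrightarrow> 0 \<le> v \<longrightarrow> u + v = 1 \<longrightarrow>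
        f (u *\<^sub>R x + v *\<^sub>R y) \<le> ereal u * f x + ereal v * f y)"

definition lower_semicontinuous :: "('a::topological_space \<Rightarrow> ereal) \<Rightarrow> bool" where
  "lower_semicontinuous f \<longleftrightarrow> (\<forall>x. f x \<le> Liminf (at x) f)"

definition argmin_set :: "('a \<Rightarrow> ereal) \<Rightarrow> 'a set" where
  "argmin_set f = {x. is_arg_min f (\<lambda>_. True) x}"

(* For proper f this set is empty at points where f takes the value \<infinity>. *)
definition subdifferential :: "('a::real_inner \<Rightarrow> ereal) \<Rightarrow> 'a \<Rightarrow> 'a set" where
  "subdifferential f x = {p. \<forall>y. f x + ereal (p \<bullet> (y - x)) \<le> f y}"

(* The elements of a division are nonempty compact intervals {a..b} = {Inf K..Sup K}
   with pairwise disjoint interiors, finite in number. *)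
definition absolutely_continuous_fun_on :: "real set \<Rightarrow> (real \<Rightarrow> 'a::real_normed_vector) \<Rightarrow> bool" where
  "absolutely_continuous_fun_on I g \<longleftrightarrow>
     (\<forall>\<epsilon>>0. \<exists>\<delta>>0. \<forall>\<D>. \<D> division_of \<Union>\<D> \<and> \<Union>\<D> \<subseteq> I \<and> (\<Sum>K\<in>\<D>. Sup K - Inf K) < \<delta> \<longrightarrow>
        (\<Sum>K\<in>\<D>. norm (g (Sup K) - g (Inf K))) < \<epsilon>)"

(* Only the values of v and x on {t0..} matter: derivatives are taken within {t0..}. *)
definition strong_solution ::
    "('a::real_inner \<Rightarrow> ereal) \<Rightarrow> real \<Rightarrow> real \<Rightarrow> real \<Rightarrow> (real \<Rightarrow> 'a) \<Rightarrow> (real \<Rightarrow> 'a) \<Rightarrow> bool" where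
  "strong_solution f r \<alpha> t0 v x \<longleftrightarrow>
     continuous_on {t0..} v \<and> continuous_on {t0..} x \<and>
     (\<forall>a b. t0 \<le> a \<longrightarrow> a \<le> b \<longrightarrow>
        absolutely_continuous_fun_on {a..b} v \<and> absolutely_continuous_fun_on {a..b} x) \<and>
     (AE t in lborel. t0 \<le> t \<longrightarrow>
        (\<exists>v' x'. (v has_vector_derivative v') (at t within {t0..}) \<and>
           (x has_vector_derivative x') (at t within {t0..}) \<and>
           (\<exists>p\<in>subdifferential f (v t).
              v' + (t / (\<alpha> - 1)) *\<^sub>R p
                 + (2 powr r * (\<alpha> - 1) powr (r - 1) / t powr (2 * r - 1)) *\<^sub>R v t = 0) \<and>
           x' + ((\<alpha> - 1) / t) *\<^sub>R (x t - v t) = 0))"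

(* x solves, in the generalized sense and with x(t0) = x0 and x'(t0) = 0, the inclusion
     x'' + (\<alpha>/t + c(t)) x' + \<partial>f(x + t/(\<alpha>-1) x') + ((\<alpha>-1)/t) c(t) x \<ni> 0,
     c(t) = 2^r (\<alpha>-1)^(r-1) / t^(2r-1).
   The auxiliary v stands for x + t/(\<alpha>-1) x', so the condition x'(t0) = 0 reads v(t0) = x(t0). *)
definition generalized_solution ::
    "('a::real_inner \<Rightarrow> ereal) \<Rightarrow> real \<Rightarrow> real \<Rightarrow> real \<Rightarrow> 'a \<Rightarrow> (real \<Rightarrow> 'a) \<Rightarrow> bool" where
  "generalized_solution f r \<alpha> t0 x0 x \<longleftrightarrow>
     (\<exists>v. strong_solution f r \<alpha> t0 v x \<and> v t0 = x0 \<and> x t0 = x0)"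

end

theory Submission
  imports Defs
begin

text \<open>
Write \<open>\<kappa> = \<alpha> - 1\<close> and let \<open>x\<^sup>*\<close> be the minimizer of least norm. In the time \<open>t\<^sup>2 / (2 \<kappa>)\<close> the
variable \<open>v\<close> follows the subgradient flow of \<open>f\<close> with a Tikhonov term whose coefficient
\<open>eps t\<close>, a multiple of \<open>t powr (- 2 r)\<close>, vanishes slowly, and \<open>x\<close> is an average of the
past of \<open>v\<close> with weight \<open>s powr (\<kappa> - 1)\<close>. The reference curve is the Tikhonov path
\<open>X t = argmin (f + eps t / 2 * norm\<^sup>2)\<close>, which converges to \<open>x\<^sup>*\<close> (lemma \<open>tikhonov_tendsto\<close>).

The path moves at speed at most \<open>2 r / t * norm x\<^sup>*\<close>, whereas the flow contracts towards its
current point at rate \<open>t / \<kappa> * eps t\<close>, a multiple of \<open>t powr (1 - 2 r)\<close>. Balancing the two gives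
\<open>norm (v t - X t) = O(t powr (2 r - 2))\<close> (lemma \<open>d_bound\<close>), which tends to zero since
\<open>r < 1\<close>. Hence \<open>v\<close>, and then its average \<open>x\<close>, converges to \<open>x\<^sup>*\<close>.

For the values, let \<open>u = norm (v - X)\<^sup>2 / 2\<close>. The subgradient inequality between \<open>v\<close> and \<open>X\<close>
bounds \<open>f (v t) - min f\<close> by \<open>f (X t) - min f\<close>, plus a term \<open>O(1 / t\<^sup>2)\<close>, minus \<open>\<kappa> / t\<close> times the
derivative of \<open>u\<close>. Averaging this with the weight above and using convexity yields a bound
on \<open>f (x t) - min f\<close> (lemma \<open>gap_x_le\<close>). If \<open>2 r < \<kappa>\<close>, the estimate
\<open>f (X t) - min f = O(t powr (- 2 r))\<close> is enough. If \<open>\<kappa> \<le> 2 r\<close>, it would lose a logarithm at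
\<open>\<kappa> = 2 r\<close>. What helps is the identity that \<open>f (X t) - min f\<close> is, up to a constant,
\<open>t powr (1 - 2 r)\<close> times the derivative of
\<open>(min (f + eps t / 2 * norm\<^sup>2) - min f) / eps t\<close>; this quotient stays between \<open>0\<close> and
\<open>norm x\<^sup>*\<^sup>2 / 2\<close>, so the weighted integral of \<open>f (X t) - min f\<close> converges.

All the integrations are done on scalar functions, through one principle (lemma
\<open>ac_upper_slope_nonpos_imp_le\<close>): an absolutely continuous function whose two-sided difference
quotients have nonpositive upper limit at almost every point does not increase. Upper
slopes replace derivatives because \<open>X\<close> is only known to be locally Lipschitz. Neither
differentiability of \<open>f\<close> along the trajectory nor an integral form of Jensen's inequality
enters: convexity is applied through affine minorants supplied by proximal points.
\<close>

section \<open>Two-sided upper slopes\<close>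

text \<open>
The upper limit of the difference quotients is taken from both sides, because the bounds
on \<open>g w - g t\<close> for \<open>w > t\<close> and on \<open>g t - g s\<close> for \<open>s < t\<close> then add up over an interval
that has its tag \<open>t\<close> anywhere inside.
\<close>

definition upper_slope_le :: "(real \<Rightarrow> real) \<Rightarrow> real \<Rightarrow> real \<Rightarrow> bool" where
  "upper_slope_le g t \<sigma> \<longleftrightarrow> (\<forall>\<eta>>0. \<forall>\<^sub>F s in at t. (g s - g t) / (s - t) \<le> \<sigma> + \<eta>)"

lemma upper_slope_leI:
  assumes "\<forall>\<^sub>F s in at t. (g s - g t) / (s - t) \<le> B s" and "(B \<longlongrightarrow> \<sigma>) (at t)"
  shows "upper_slope_le g t \<sigma>"
  unfolding upper_slope_le_def
proof (intro allI impI)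
  fix \<eta> :: real assume "\<eta> > 0"
  then have "\<forall>\<^sub>F s in at t. B s < \<sigma> + \<eta>"
    using assms(2) by (intro order_tendstoD) auto
  with assms(1) show "\<forall>\<^sub>F s in at t. (g s - g t) / (s - t) \<le> \<sigma> + \<eta>"
    by eventually_elim simp
qed

lemma upper_slope_le_deriv:
  assumes "(g has_real_derivative \<sigma>) (at t)"
  shows "upper_slope_le g t \<sigma>"
  using assms by (intro upper_slope_leI[where B="\<lambda>s. (g s - g t) / (s - t)"])
    (auto simp: has_field_derivative_iff)

lemma upper_slope_le_mono:
  assumes "upper_slope_le g t \<sigma>" and "\<sigma> \<le> \<sigma>'"
  shows "upper_slope_le g t \<sigma>'"
  unfolding upper_slope_le_def
proof (intro allI impI)
  fix \<eta> :: real assume "\<eta> > 0"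
  then have "\<forall>\<^sub>F s in at t. (g s - g t) / (s - t) \<le> \<sigma> + \<eta>"
    using assms(1) by (simp add: upper_slope_le_def)
  then show "\<forall>\<^sub>F s in at t. (g s - g t) / (s - t) \<le> \<sigma>' + \<eta>"
    by eventually_elim (use assms(2) in simp)
qed

lemma upper_slope_le_add:
  assumes "upper_slope_le g t \<sigma>" and "upper_slope_le h t \<rho>"
  shows "upper_slope_le (\<lambda>s. g s + h s) t (\<sigma> + \<rho>)"
  unfolding upper_slope_le_def
proof (intro allI impI)
  fix \<eta> :: real assume "\<eta> > 0"
  then have "\<forall>\<^sub>F s in at t. (g s - g t) / (s - t) \<le> \<sigma> + \<eta>/2"
    and "\<forall>\<^sub>F s in at t. (h s - h t) / (s - t) \<le> \<rho> + \<eta>/2"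
    using assms by (simp_all add: upper_slope_le_def)
  then show "\<forall>\<^sub>F s in at t. (g s + h s - (g t + h t)) / (s - t) \<le> \<sigma> + \<rho> + \<eta>"
  proof eventually_elim
    case (elim s)
    have "(g s + h s - (g t + h t)) / (s - t) = (g s - g t) / (s - t) + (h s - h t) / (s - t)"
      by (simp add: add_divide_distrib diff_divide_distrib)
    then show ?case using elim by linarith
  qed
qed

lemma upper_slope_le_mult:
  assumes c: "(c has_real_derivative c') (at t)" "0 < c t" and g: "upper_slope_le g t \<sigma>"
  shows "upper_slope_le (\<lambda>s. c s * g s) t (c t * \<sigma> + c' * g t)"
  unfolding upper_slope_le_def
proof (intro allI impI)
  fix \<eta> :: real assume "\<eta> > 0"
  define \<eta>1 where "\<eta>1 = \<eta> / (2 * c t)"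
  have "\<eta>1 > 0" using \<open>\<eta> > 0\<close> c(2) by (simp add: \<eta>1_def)
  then have E1: "\<forall>\<^sub>F s in at t. (g s - g t) / (s - t) \<le> \<sigma> + \<eta>1"
    using g by (simp add: upper_slope_le_def)
  have ct: "(c \<longlongrightarrow> c t) (at t)"
    using DERIV_isCont[OF c(1)] by (simp add: isCont_def)
  have E2: "\<forall>\<^sub>F s in at t. 0 < c s" using order_tendstoD(1)[OF ct c(2)] .
  have "((\<lambda>s. c s * (\<sigma> + \<eta>1) + g t * ((c s - c t) / (s - t))) \<longlongrightarrow> c t * (\<sigma> + \<eta>1) + g t * c') (at t)"
    using c(1) by (intro tendsto_intros ct) (auto simp: has_field_derivative_iff)
  moreover have "c t * (\<sigma> + \<eta>1) + g t * c' < c t * \<sigma> + c' * g t + \<eta>"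
    using c(2) \<open>\<eta> > 0\<close> by (simp add: \<eta>1_def field_simps)
  ultimately have E3: "\<forall>\<^sub>F s in at t. c s * (\<sigma> + \<eta>1) + g t * ((c s - c t) / (s - t))
      < c t * \<sigma> + c' * g t + \<eta>"
    by (rule order_tendstoD(2))
  from E1 E2 E3
  show "\<forall>\<^sub>F s in at t. (c s * g s - c t * g t) / (s - t) \<le> c t * \<sigma> + c' * g t + \<eta>"
  proof eventually_elim
    case (elim s)
    have "(c s * g s - c t * g t) / (s - t) = c s * ((g s - g t) / (s - t)) + g t * ((c s - c t) / (s - t))"
      by (simp add: diff_divide_distrib right_diff_distrib mult.commute)
    moreover have "c s * ((g s - g t) / (s - t)) \<le> c s * (\<sigma> + \<eta>1)"
      using elim by (intro mult_left_mono) auto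
    ultimately show ?case using elim by linarith
  qed
qed

section \<open>Absolutely continuous functions\<close>

lemma division_of_real_interval:
  fixes D :: "real set set"
  assumes "D division_of S" "K \<in> D"
  obtains a b where "K = {a..b}" "a \<le> b"
proof -
  obtain a b where "K = cbox a b" using division_ofD(4)[OF assms] by blast
  moreover have "K \<noteq> {}" using division_ofD(3)[OF assms] .
  ultimately show thesis using that[of a b] by auto
qed

text \<open>
The closure properties below reduce to this one. The increments over a division are summed
termwise, so the smaller of the two values of \<open>\<delta>\<close> for \<open>\<epsilon>\<close> divided by a multiple of the
constant serves the dominated function.
\<close>

lemma ac_dominated:
  fixes g1 :: "real \<Rightarrow> 'b::real_normed_vector" and g2 :: "real \<Rightarrow> 'c::real_normed_vector"
    and h :: "real \<Rightarrow> 'd::real_normed_vector"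
  assumes g: "absolutely_continuous_fun_on I g1" "absolutely_continuous_fun_on I g2"
    and h: "\<And>s t. s \<in> I \<Longrightarrow> t \<in> I \<Longrightarrow> s \<le> t \<Longrightarrow>
              norm (h t - h s) \<le> C * (norm (g1 t - g1 s) + norm (g2 t - g2 s))"
  shows "absolutely_continuous_fun_on I h"
  unfolding absolutely_continuous_fun_on_def
proof (intro allI impI)
  fix \<epsilon> :: real assume "\<epsilon> > 0"
  define \<epsilon>1 where "\<epsilon>1 = \<epsilon> / (2 * (\<bar>C\<bar> + 1))"
  have "\<epsilon>1 > 0" using \<open>\<epsilon> > 0\<close> by (simp add: \<epsilon>1_def add_nonneg_pos)
  obtain d1 where d1: "d1 > 0"
    and 1: "\<forall>D. D division_of \<Union>D \<and> \<Union>D \<subseteq> I \<and> (\<Sum>K\<in>D. Sup K - Inf K) < d1 \<longrightarrow>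
        (\<Sum>K\<in>D. norm (g1 (Sup K) - g1 (Inf K))) < \<epsilon>1"
    using g(1) \<open>\<epsilon>1 > 0\<close> unfolding absolutely_continuous_fun_on_def by blast
  obtain d2 where d2: "d2 > 0"
    and 2: "\<forall>D. D division_of \<Union>D \<and> \<Union>D \<subseteq> I \<and> (\<Sum>K\<in>D. Sup K - Inf K) < d2 \<longrightarrow>
        (\<Sum>K\<in>D. norm (g2 (Sup K) - g2 (Inf K))) < \<epsilon>1"
    using g(2) \<open>\<epsilon>1 > 0\<close> unfolding absolutely_continuous_fun_on_def by blast
  show "\<exists>\<delta>>0. \<forall>\<D>. \<D> division_of \<Union>\<D> \<and> \<Union>\<D> \<subseteq> I \<and> (\<Sum>K\<in>\<D>. Sup K - Inf K) < \<delta> \<longrightarrow>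
        (\<Sum>K\<in>\<D>. norm (h (Sup K) - h (Inf K))) < \<epsilon>"
  proof (intro exI[of _ "min d1 d2"] conjI allI impI)
    fix D assume D: "D division_of \<Union>D \<and> \<Union>D \<subseteq> I \<and> (\<Sum>K\<in>D. Sup K - Inf K) < min d1 d2"
    have "(\<Sum>K\<in>D. norm (h (Sup K) - h (Inf K)))
        \<le> (\<Sum>K\<in>D. (\<bar>C\<bar> + 1) * (norm (g1 (Sup K) - g1 (Inf K)) + norm (g2 (Sup K) - g2 (Inf K))))"
    proof (rule sum_mono)
      fix K assume K: "K \<in> D"
      obtain a b where ab: "K = {a..b}" "a \<le> b"
        using conjunct1[OF D] K by (rule division_of_real_interval)
      have "K \<subseteq> I" using D K by blast
      then have "norm (h (Sup K) - h (Inf K))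
          \<le> C * (norm (g1 (Sup K) - g1 (Inf K)) + norm (g2 (Sup K) - g2 (Inf K)))"
        using ab by (intro h) auto
      also have "\<dots> \<le> (\<bar>C\<bar> + 1) * (norm (g1 (Sup K) - g1 (Inf K)) + norm (g2 (Sup K) - g2 (Inf K)))"
        by (intro mult_right_mono) auto
      finally show "norm (h (Sup K) - h (Inf K)) \<le> \<dots>" .
    qed
    also have "\<dots> = (\<bar>C\<bar> + 1) * ((\<Sum>K\<in>D. norm (g1 (Sup K) - g1 (Inf K)))
        + (\<Sum>K\<in>D. norm (g2 (Sup K) - g2 (Inf K))))"
      by (simp only: sum_distrib_left[symmetric] sum.distrib)
    also have "\<dots> < (\<bar>C\<bar> + 1) * (\<epsilon>1 + \<epsilon>1)"
      using 1 2 D by (intro mult_strict_left_mono add_strict_mono) auto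
    also have "\<dots> = \<epsilon>"
    proof -
      have "\<bar>C\<bar> + 1 \<noteq> 0" by linarith
      then have "(\<bar>C\<bar> + 1) * \<epsilon>1 = \<epsilon> / 2"
        unfolding \<epsilon>1_def times_divide_eq_right mult.commute[of 2]
        by (rule nonzero_mult_divide_mult_cancel_left)
      then show ?thesis by (simp add: distrib_left)
    qed
    finally show "(\<Sum>K\<in>D. norm (h (Sup K) - h (Inf K))) < \<epsilon>" .
  qed (use d1 d2 in auto)
qed

lemma ac_ident: "absolutely_continuous_fun_on I (\<lambda>t. t)"
  unfolding absolutely_continuous_fun_on_def
proof (intro allI impI exI conjI)
  fix \<epsilon> :: real and D assume "\<epsilon> > 0"
    and D: "D division_of \<Union>D \<and> \<Union>D \<subseteq> I \<and> (\<Sum>K\<in>D. Sup K - Inf K) < \<epsilon>"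
  have "norm (Sup K - Inf K) = Sup K - Inf K" if K: "K \<in> D" for K
  proof -
    obtain a b where "K = {a..b}" "a \<le> b"
      using conjunct1[OF D] K by (rule division_of_real_interval)
    then show ?thesis by simp
  qed
  then show "(\<Sum>K\<in>D. norm (Sup K - Inf K)) < \<epsilon>" using D by simp
qed

lemma ac_Lipschitz:
  fixes h :: "real \<Rightarrow> 'd::real_normed_vector"
  assumes "\<And>s t. s \<in> I \<Longrightarrow> t \<in> I \<Longrightarrow> s \<le> t \<Longrightarrow> norm (h t - h s) \<le> C * (t - s)"
  shows "absolutely_continuous_fun_on I h"
proof (rule ac_dominated[OF ac_ident ac_ident])
  show "norm (h t - h s) \<le> (C / 2) * (norm (t - s) + norm (t - s))"
    if "s \<in> I" "t \<in> I" "s \<le> t" for s t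
    using assms[OF that] that(3) by (simp add: field_simps)
qed

lemma ac_add:
  assumes "absolutely_continuous_fun_on I g" "absolutely_continuous_fun_on I h"
  shows "absolutely_continuous_fun_on I (\<lambda>t. g t + h t)"
proof (rule ac_dominated[OF assms])
  show "norm (g t + h t - (g s + h s)) \<le> 1 * (norm (g t - g s) + norm (h t - h s))" for s t
    using norm_triangle_ineq[of "g t - g s" "h t - h s"] by (simp add: algebra_simps)
qed

lemma ac_diff:
  assumes "absolutely_continuous_fun_on I g" "absolutely_continuous_fun_on I h"
  shows "absolutely_continuous_fun_on I (\<lambda>t. g t - h t)"
proof (rule ac_dominated[OF assms])
  show "norm (g t - h t - (g s - h s)) \<le> 1 * (norm (g t - g s) + norm (h t - h s))" for s t
    using norm_triangle_ineq4[of "g t - g s" "h t - h s"] by (simp add: algebra_simps)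
qed

lemma ac_const: "absolutely_continuous_fun_on I (\<lambda>t. c)"
  by (rule ac_Lipschitz[where C=0]) simp

lemma ac_cmult:
  fixes g :: "real \<Rightarrow> real"
  assumes "absolutely_continuous_fun_on I g"
  shows "absolutely_continuous_fun_on I (\<lambda>t. c * g t)"
proof (rule ac_dominated[OF assms assms])
  show "norm (c * g t - c * g s) \<le> \<bar>c\<bar> * (norm (g t - g s) + norm (g t - g s))" for s t
    by (simp add: right_diff_distrib[symmetric] abs_mult)
qed

lemma lipschitz_imp_continuous_on:
  fixes g :: "real \<Rightarrow> 'b::real_normed_vector"
  assumes "\<And>s t. s \<in> S \<Longrightarrow> t \<in> S \<Longrightarrow> norm (g t - g s) \<le> C * \<bar>t - s\<bar>" and "C \<ge> 0"
  shows "continuous_on S g"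
proof -
  have "C-lipschitz_on S g"
    using assms by (intro lipschitz_onI) (auto simp: dist_norm)
  then show ?thesis by (rule lipschitz_on_continuous_on)
qed

lemma powr_mult_eq_inverse_square:
  fixes t :: real
  assumes "0 < t"
  shows "t powr (a - 2) * t powr (- a) = 1 / t\<^sup>2"
proof -
  have "t powr (a - 2) * t powr (- a) = t powr (- 2)"
    by (simp only: powr_add[symmetric]) simp
  also have "\<dots> = 1 / t\<^sup>2"
    using assms by (simp only: powr_minus_divide) simp
  finally show ?thesis .
qed

lemma continuous_on_interval_bounded:
  fixes g :: "real \<Rightarrow> 'b::real_normed_vector"
  assumes "continuous_on {a..b} g"
  obtains M where "M \<ge> 0" "\<forall>t\<in>{a..b}. norm (g t) \<le> M"
proof -
  have "bounded (g ` {a..b})"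
    using assms by (intro compact_imp_bounded compact_continuous_image) auto
  then obtain M where "M > 0" "\<forall>y\<in>g ` {a..b}. norm y \<le> M"
    by (auto simp only: bounded_pos)
  then show thesis by (intro that[of M]) auto
qed

lemma ac_inner:
  fixes g h :: "real \<Rightarrow> 'b::real_inner"
  assumes ac: "absolutely_continuous_fun_on {a..b} g" "absolutely_continuous_fun_on {a..b} h"
    and cont: "continuous_on {a..b} g" "continuous_on {a..b} h"
  shows "absolutely_continuous_fun_on {a..b} (\<lambda>t. g t \<bullet> h t)"
proof -
  obtain M1 where M1: "\<forall>t\<in>{a..b}. norm (g t) \<le> M1"
    using cont(1) by (rule continuous_on_interval_bounded)
  obtain M2 where M2: "\<forall>t\<in>{a..b}. norm (h t) \<le> M2"
    using cont(2) by (rule continuous_on_interval_bounded)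
  show ?thesis
  proof (rule ac_dominated[OF ac])
    fix s t assume st: "s \<in> {a..b}" "t \<in> {a..b}" "s \<le> t"
    have "g t \<bullet> h t - g s \<bullet> h s = (g t - g s) \<bullet> h t + g s \<bullet> (h t - h s)"
      by (simp add: inner_diff_left inner_diff_right)
    also have "norm \<dots> \<le> norm (g t - g s) * norm (h t) + norm (g s) * norm (h t - h s)"
      by (intro norm_triangle_le add_mono) (simp_all add: Cauchy_Schwarz_ineq2)
    also have "\<dots> \<le> norm (g t - g s) * max M1 M2 + max M1 M2 * norm (h t - h s)"
      using bspec[OF M2 st(2)] bspec[OF M1 st(1)]
      by (intro add_mono mult_left_mono mult_right_mono) (auto simp: le_max_iff_disj)
    finally show "norm (g t \<bullet> h t - g s \<bullet> h s) \<le> max M1 M2 * (norm (g t - g s) + norm (h t - h s))"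
      by (simp add: algebra_simps)
  qed
qed

lemma ac_mult:
  fixes g h :: "real \<Rightarrow> real"
  assumes "absolutely_continuous_fun_on {a..b} g" "absolutely_continuous_fun_on {a..b} h"
    and "continuous_on {a..b} g" "continuous_on {a..b} h"
  shows "absolutely_continuous_fun_on {a..b} (\<lambda>t. g t * h t)"
  using ac_inner[OF assms] by simp

lemma powr_Lipschitz:
  fixes a b c :: real
  assumes "0 < a"
  obtains C where "C \<ge> 0" "\<And>s t. s \<in> {a..b} \<Longrightarrow> t \<in> {a..b} \<Longrightarrow> \<bar>t powr c - s powr c\<bar> \<le> C * \<bar>t - s\<bar>"
proof -
  have "continuous_on {a..b} (\<lambda>t. c * t powr (c - 1))"
    using assms by (intro continuous_intros) auto
  then obtain C where C: "C \<ge> 0" "\<forall>t\<in>{a..b}. norm (c * t powr (c - 1)) \<le> C"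
    by (rule continuous_on_interval_bounded)
  have *: "((\<lambda>t. t powr c) has_field_derivative (c * t powr (c - 1))) (at t within {a..b})"
    if "t \<in> {a..b}" for t
    using that assms by (auto intro!: derivative_eq_intros)
  have "norm (t powr c - s powr c) \<le> C * norm (t - s)" if "s \<in> {a..b}" "t \<in> {a..b}" for s t
    using C(2) by (intro field_differentiable_bound[OF convex_real_interval(5) * _ that(2,1)]) blast+
  then show thesis using C(1) by (intro that[of C]) auto
qed

lemma ac_powr:
  fixes a b c :: real
  assumes "0 < a"
  shows "absolutely_continuous_fun_on {a..b} (\<lambda>t. t powr c)"
proof -
  obtain C where C: "C \<ge> 0" "\<And>s t. s \<in> {a..b} \<Longrightarrow> t \<in> {a..b} \<Longrightarrow> \<bar>t powr c - s powr c\<bar> \<le> C * \<bar>t - s\<bar>"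
    using powr_Lipschitz[OF assms, of b c] by auto
  show ?thesis 
  proof (rule ac_Lipschitz)
    show "norm (t powr c - s powr c) \<le> C * (t - s)" if "s \<in> {a..b}" "t \<in> {a..b}" "s \<le> t" for s t
      using C(2)[OF that(1,2)] that(3) by simp
  qed
qed

section \<open>Monotonicity from an almost everywhere slope bound\<close>

text \<open>
This replaces the fundamental theorem of calculus. Choose a gauge that, off the exceptional
null set, makes every difference quotient at the tag at most \<open>\<epsilon>\<close>, and on the null set
confines the interval to an open set of measure less than \<open>\<delta>\<close>. In a fine tagged division
the intervals of the first kind contribute at most \<open>\<epsilon> * (b - a)\<close> to \<open>g b - g a\<close>, and those
of the second kind at most \<open>\<epsilon>\<close> by absolute continuity.
\<close>

lemma ac_upper_slope_nonpos_imp_le: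
  fixes g :: "real \<Rightarrow> real"
  assumes ac: "absolutely_continuous_fun_on {a..b} g" and "a \<le> b"
    and slope: "AE t in lborel. a < t \<longrightarrow> t < b \<longrightarrow> upper_slope_le g t 0"
  shows "g b \<le> g a"
proof (rule field_le_epsilon)
  fix \<epsilon>0 :: real assume "\<epsilon>0 > 0"
  define \<epsilon> where "\<epsilon> = \<epsilon>0 / (b - a + 1)"
  have "\<epsilon> > 0" "\<epsilon> * (b - a + 1) = \<epsilon>0" using \<open>\<epsilon>0 > 0\<close> \<open>a \<le> b\<close> by (auto simp: \<epsilon>_def)
  then have \<epsilon>: "\<epsilon> > 0" "\<epsilon> * (b - a) + \<epsilon> = \<epsilon>0" by (auto simp: algebra_simps)
  obtain \<delta> where "\<delta> > 0" and \<delta>: "\<forall>D. D division_of \<Union>D \<and> \<Union>D \<subseteq> {a..b} \<and>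
      (\<Sum>K\<in>D. Sup K - Inf K) < \<delta> \<longrightarrow> (\<Sum>K\<in>D. norm (g (Sup K) - g (Inf K))) < \<epsilon>"
    using ac[unfolded absolutely_continuous_fun_on_def, rule_format, OF \<open>\<epsilon> > 0\<close>] by auto
  obtain N0 where N0: "N0 \<in> null_sets lborel"
    "{t \<in> space lborel. \<not> (a < t \<longrightarrow> t < b \<longrightarrow> upper_slope_le g t 0)} \<subseteq> N0"
    using slope by (auto simp: eventually_ae_filter)
  define N where "N = N0 \<union> {a, b}"
  have Nnull: "N \<in> null_sets lebesgue"
    using N0(1) null_sets_completionI unfolding N_def
    by (intro null_sets.Un) (auto intro: null_sets_completionI)
  then have "N \<in> sets lebesgue" by auto
  then obtain U where U: "open U" "N \<subseteq> U" "U - N \<in> lmeasurable" "emeasure lebesgue (U - N) < ennreal \<delta>"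
    using \<open>\<delta> > 0\<close> by (rule sets_lebesgue_outer_open)
  have emU: "emeasure lebesgue U < ennreal \<delta>"
  proof -
    have "emeasure lebesgue (U - N) = emeasure lebesgue U"
      using Nnull U by (intro emeasure_Diff_null_set) auto
    then show ?thesis using U by simp
  qed
  have ex: "\<exists>d>0. \<forall>s. dist s t < d \<longrightarrow> s \<noteq> t \<longrightarrow> (g s - g t) / (s - t) \<le> \<epsilon>"
    if "t \<in> {a..b}" "t \<notin> N" for t
  proof -
    have "upper_slope_le g t 0" using that N0(2) by (auto simp: N_def less_le)
    then have "\<forall>\<^sub>F s in at t. (g s - g t) / (s - t) \<le> \<epsilon>"
      using \<open>\<epsilon> > 0\<close> by (auto simp: upper_slope_le_def)
    then show ?thesis by (auto simp: eventually_at)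
  qed
  then obtain d where d: "\<And>t. t \<in> {a..b} \<Longrightarrow> t \<notin> N \<Longrightarrow> d t > 0 \<and>
      (\<forall>s. dist s t < d t \<longrightarrow> s \<noteq> t \<longrightarrow> (g s - g t) / (s - t) \<le> \<epsilon>)" by metis
  (* Endpoints were put into the null set, since the slope is only controlled in the interior. *)
  define \<gamma> where "\<gamma> t = (if t \<in> N then U else if t \<in> {a..b} then ball t (d t) else UNIV)" for t
  have "gauge \<gamma>" using U d by (auto simp: gauge_def \<gamma>_def)
  then obtain p where p: "p tagged_division_of {a..b}" "\<gamma> fine p"
    by (rule fine_division_exists_real)
  have fin: "finite p" using p(1) by (rule tagged_division_of_finite)
  have pk: "\<exists>u w. k = {u..w} \<and> u \<le> t \<and> t \<le> w \<and> a \<le> u \<and> w \<le> b" if tk: "(t, k) \<in> p" for t k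
  proof -
    obtain u w where uw: "k = cbox u w" using tagged_division_ofD(4)[OF p(1) tk] by blast
    have "t \<in> k" "k \<subseteq> {a..b}" using tagged_division_ofD(2,3)[OF p(1) tk] by auto
    then show ?thesis using uw by (intro exI[of _ u] exI[of _ w]) auto
  qed
  have tele: "g b - g a = (\<Sum>(t, k)\<in>p. g (Sup k) - g (Inf k))"
    using additive_tagged_division_1[OF \<open>a \<le> b\<close> p(1), of g] by simp
  define p1 where "p1 = {(t, k) \<in> p. t \<in> N}"
  have p1: "p1 \<subseteq> p" by (auto simp: p1_def)
  have split: "(\<Sum>(t, k)\<in>p. g (Sup k) - g (Inf k))
     = (\<Sum>(t, k)\<in>p1. g (Sup k) - g (Inf k)) + (\<Sum>(t, k)\<in>p - p1. g (Sup k) - g (Inf k))"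
    using sum.subset_diff[OF p1 fin, of "\<lambda>(t, k). g (Sup k) - g (Inf k)"] by simp
  have good: "(\<Sum>(t, k)\<in>p - p1. g (Sup k) - g (Inf k)) \<le> \<epsilon> * (b - a)"
  proof -
    have "(\<Sum>(t, k)\<in>p - p1. g (Sup k) - g (Inf k)) \<le> (\<Sum>(t, k)\<in>p - p1. \<epsilon> * measure lborel k)"
    proof (rule sum_mono, clarify)
      fix t k assume tk: "(t, k) \<in> p" "(t, k) \<notin> p1"
      then have tN: "t \<notin> N" by (auto simp: p1_def)
      obtain u w where uw: "k = {u..w}" "u \<le> t" "t \<le> w" "a \<le> u" "w \<le> b"
        using pk[OF tk(1)] by blast
      have tab: "t \<in> {a..b}" using uw by auto
      have "k \<subseteq> ball t (d t)" using fineD[OF p(2) tk(1)] tN tab by (simp add: \<gamma>_def)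
      moreover have "u \<in> k" "w \<in> k" using uw by auto
      ultimately have near: "dist u t < d t" "dist w t < d t" by (auto simp: dist_commute)
      have "g w - g t \<le> \<epsilon> * (w - t)"
      proof (cases "w = t")
        case False
        then show ?thesis using d[OF tab tN] near(2) uw(3) by (auto simp: pos_divide_le_eq)
      qed simp
      moreover have "g t - g u \<le> \<epsilon> * (t - u)"
      proof (cases "u = t")
        case False
        then show ?thesis using d[OF tab tN] near(1) uw(2)
          by (auto simp: neg_divide_le_eq algebra_simps)
      qed simp
      ultimately show "g (Sup k) - g (Inf k) \<le> \<epsilon> * measure lborel k"
        using uw by (simp add: algebra_simps)
    qed
    also have "\<dots> \<le> (\<Sum>(t, k)\<in>p. \<epsilon> * measure lborel k)"
      using fin \<open>\<epsilon> > 0\<close> by (intro sum_mono2) auto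
    also have "\<dots> = \<epsilon> * (\<Sum>(t, k)\<in>p. measure lborel k)"
      by (simp add: sum_distrib_left case_prod_unfold)
    also have "(\<Sum>(t, k)\<in>p. measure lborel k) = b - a"
      using additive_content_tagged_division[of p a b] p(1) \<open>a \<le> b\<close> by simp
    finally show ?thesis .
  qed
  have bad: "(\<Sum>(t, k)\<in>p1. g (Sup k) - g (Inf k)) \<le> \<epsilon>"
  proof -
    define D where "D = snd ` p1"
    have p1t: "p1 tagged_division_of \<Union>D"
      unfolding D_def
      using p(1) tagged_partial_division_subset[OF _ p1]
      by (intro tagged_partial_division_of_Union_self[of _ "{a..b}"]) (simp add: tagged_division_of_def)
    have Ddiv: "D division_of \<Union>D"
      using division_of_tagged_division[OF p1t] by (simp add: D_def)
    have "k \<subseteq> {a..b} \<and> k \<subseteq> U" if "(t, k) \<in> p1" for t k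
    proof -
      have tk: "(t, k) \<in> p" "t \<in> N" using that by (auto simp: p1_def)
      then show ?thesis using tagged_division_ofD(3)[OF p(1) tk(1)] fineD[OF p(2) tk(1)]
        by (simp add: \<gamma>_def)
    qed
    then have Dsub: "\<Union>D \<subseteq> {a..b}" "\<Union>D \<subseteq> U" unfolding D_def by fastforce+
    have KD: "\<exists>u w. K = {u..w} \<and> u \<le> w" if "K \<in> D" for K
      using that pk p1 by (force simp: D_def)
    have "(\<Sum>K\<in>D. Sup K - Inf K) = (\<Sum>K\<in>D. measure lebesgue K)"
      using KD by (intro sum.cong refl) force
    also have "\<dots> = measure lebesgue (\<Union>D)"
      using content_division[OF Ddiv] .
    also have "\<dots> < \<delta>"
    proof -
      have "emeasure lebesgue (\<Union>D) \<le> emeasure lebesgue U"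
        using Dsub(2) U by (intro emeasure_mono) auto
      then have "emeasure lebesgue (\<Union>D) < ennreal \<delta>" using emU by simp
      then show ?thesis using \<open>\<delta> > 0\<close>
        by (cases "emeasure lebesgue (\<Union>D)") (auto simp: measure_def ennreal_less_iff)
    qed
    finally have "(\<Sum>K\<in>D. norm (g (Sup K) - g (Inf K))) < \<epsilon>"
      using \<delta> Ddiv Dsub(1) by blast
    moreover have "(\<Sum>(t, k)\<in>p1. g (Sup k) - g (Inf k)) = (\<Sum>k\<in>D. g (Sup k) - g (Inf k))"
    proof -
      (* The collapse of a sum over a tagged division to a sum over its intervals needs a summand
         that vanishes on the empty interval, where Sup and Inf are arbitrary. *)
      define \<phi> where "\<phi> k = (if k = {} then 0 else g (Sup k) - g (Inf k))" for k
      have "\<phi> (cbox u w) = 0" if "box u w = {}" for u w :: real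
        using that by (cases "u = w") (auto simp: \<phi>_def)
      then have "(\<Sum>(t, k)\<in>p1. \<phi> k) = (\<Sum>k\<in>D. \<phi> k)"
        unfolding D_def by (rule sum.over_tagged_division_lemma[OF p1t])
      moreover have ne: "k \<noteq> {}" if "k \<in> D" for k
        using KD[OF that] by auto
      have "(\<Sum>k\<in>D. \<phi> k) = (\<Sum>k\<in>D. g (Sup k) - g (Inf k))"
        using ne by (intro sum.cong) (auto simp: \<phi>_def)
      moreover have "(\<Sum>(t, k)\<in>p1. \<phi> k) = (\<Sum>(t, k)\<in>p1. g (Sup k) - g (Inf k))"
        using ne by (intro sum.cong) (force simp: \<phi>_def D_def)+
      ultimately show ?thesis by simp
    qed
    moreover have "\<dots> \<le> (\<Sum>K\<in>D. norm (g (Sup K) - g (Inf K)))"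
      by (intro sum_mono) auto
    ultimately show ?thesis by linarith
  qed
  show "g b \<le> g a + \<epsilon>0" using tele split good bad \<epsilon>(2) by linarith
qed

text \<open>
The previous lemma applies from the last point where \<open>g \<le> 0\<close> up to \<open>b\<close>, because there the slope bound holds almost everywhere.
\<close>

lemma ac_upper_slope_barrier:
  fixes g :: "real \<Rightarrow> real"
  assumes ac: "\<And>c d. a \<le> c \<Longrightarrow> d \<le> b \<Longrightarrow> absolutely_continuous_fun_on {c..d} g" and "a \<le> b"
    and cont: "continuous_on {a..b} g"
    and slope: "AE t in lborel. a < t \<longrightarrow> t < b \<longrightarrow> g t > 0 \<longrightarrow> upper_slope_le g t 0"
    and "g a \<le> 0"
  shows "g b \<le> 0"
proof (rule ccontr)
  assume "\<not> g b \<le> 0"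
  define Z where "Z = {t \<in> {a..b}. g t \<le> 0}"
  have "closed Z"
    unfolding Z_def
    by (rule continuous_on_closed_Collect_le[OF cont continuous_on_const closed_atLeastAtMost])
  have aZ: "a \<in> Z" using assms by (auto simp: Z_def)
  have bdd: "bdd_above Z" by (auto simp: Z_def)
  define c where "c = Sup Z"
  have "c \<in> Z" unfolding c_def using \<open>closed Z\<close> aZ bdd by (intro closed_contains_Sup) auto
  then have c: "a \<le> c" "c \<le> b" "g c \<le> 0" by (auto simp: Z_def)
  have pos: "g t > 0" if "c < t" "t \<le> b" for t
  proof (rule ccontr)
    assume "\<not> g t > 0"
    then have "t \<in> Z" using that c by (auto simp: Z_def)
    then have "t \<le> c" unfolding c_def using bdd by (rule cSup_upper)
    then show False using that by simp
  qed
  have "g b \<le> g c"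
  proof (rule ac_upper_slope_nonpos_imp_le[where g=g and a=c and b=b])
    show "AE t in lborel. c < t \<longrightarrow> t < b \<longrightarrow> upper_slope_le g t 0"
      using slope by eventually_elim (use c pos in auto)
  qed (use c ac in auto)
  then show False using c \<open>\<not> g b \<le> 0\<close> by simp
qed

section \<open>Convex functions, subgradients and proximal points\<close>

locale convex_minimum =
  fixes f :: "'a::{real_inner, complete_space} \<Rightarrow> ereal" and xmin :: 'a
  assumes convex: "convex_fun f" and lsc: "lower_semicontinuous f" and proper: "proper_fun f"
    and min_norm: "is_arg_min norm (\<lambda>y. y \<in> argmin_set f) xmin"
begin

abbreviation dom :: "'a set" where "dom \<equiv> effective_domain f"

text \<open>
The excess over the minimum as a real number. It is meaningful only on the effective domain,
since \<open>real_of_ereal\<close> sends \<open>\<infinity>\<close> to \<open>0\<close>; therefore each lemma carries a membership in \<open>dom\<close>.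
\<close>

definition gap :: "'a \<Rightarrow> real" where
  "gap y = real_of_ereal (f y) - real_of_ereal (f xmin)"

definition subgrad :: "'a \<Rightarrow> 'a \<Rightarrow> bool" where
  "subgrad p y \<longleftrightarrow> y \<in> dom \<and> (\<forall>w\<in>dom. gap y + p \<bullet> (w - y) \<le> gap w)"

lemma f_min_le: "f xmin \<le> f y"
  using min_norm by (auto simp: is_arg_min_def argmin_set_def not_less)

lemma f_eq_ereal:
  assumes "y \<in> dom"
  shows "f y = ereal (real_of_ereal (f y))"
  using assms proper unfolding effective_domain_def proper_fun_def
  by (cases "f y") auto

lemma min_in_dom: "xmin \<in> dom"
proof -
  obtain y where "f y \<noteq> \<infinity>" using proper by (auto simp: proper_fun_def)
  then show ?thesis using f_min_le[of y] by (auto simp: effective_domain_def less_top[symmetric] top_ereal_def)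
qed

lemma f_eq_gap:
  assumes "y \<in> dom"
  shows "f y = ereal (real_of_ereal (f xmin) + gap y)"
  using f_eq_ereal[OF assms] by (simp add: gap_def)

lemma gap_nonneg:
  assumes "y \<in> dom"
  shows "0 \<le> gap y"
proof -
  have "ereal (real_of_ereal (f xmin)) \<le> ereal (real_of_ereal (f xmin) + gap y)"
    using f_min_le[of y] f_eq_gap[OF assms] f_eq_ereal[OF min_in_dom] by simp
  then show ?thesis by simp
qed

lemma gap_min: "gap xmin = 0"
  by (simp add: gap_def)

lemma gap_convex:
  assumes y: "y \<in> dom" and z: "z \<in> dom" and uw: "0 \<le> u" "0 \<le> w" "u + w = 1"
  shows "u *\<^sub>R y + w *\<^sub>R z \<in> dom" and "gap (u *\<^sub>R y + w *\<^sub>R z) \<le> u * gap y + w * gap z"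
proof -
  let ?m = "real_of_ereal (f xmin)"
  have "f (u *\<^sub>R y + w *\<^sub>R z) \<le> ereal u * f y + ereal w * f z"
    using convex uw by (auto simp: convex_fun_def)
  also have "\<dots> = ereal (u * (?m + gap y) + w * (?m + gap z))"
    by (simp add: f_eq_gap[OF y] f_eq_gap[OF z])
  finally have le: "f (u *\<^sub>R y + w *\<^sub>R z) \<le> ereal (u * (?m + gap y) + w * (?m + gap z))" .
  then show d: "u *\<^sub>R y + w *\<^sub>R z \<in> dom"
    by (auto simp: effective_domain_def intro: le_less_trans)
  have "?m + gap (u *\<^sub>R y + w *\<^sub>R z) \<le> u * (?m + gap y) + w * (?m + gap z)"
    using le f_eq_gap[OF d] by simp
  also have "\<dots> = ?m + (u * gap y + w * gap z)"
    using uw(3) by (simp add: algebra_simps) (simp add: distrib_right[symmetric])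
  finally show "gap (u *\<^sub>R y + w *\<^sub>R z) \<le> u * gap y + w * gap z" by simp
qed

text \<open>
Lower semicontinuity along a sequence, in the form in which it will be used: membership of the limit
in the domain is part of the conclusion.
\<close>

lemma gap_lsc:
  assumes y: "y \<longlonglongrightarrow> z" "\<And>n. y n \<in> dom" and c: "\<And>n. gap (y n) \<le> c n" "c \<longlonglongrightarrow> C"
  shows "z \<in> dom" and "gap z \<le> C"
proof -
  let ?m = "real_of_ereal (f xmin)"
  have le: "f z \<le> ereal (?m + C + \<epsilon>)" if "\<epsilon> > 0" for \<epsilon>
  proof (rule ccontr)
    assume "\<not> f z \<le> ereal (?m + C + \<epsilon>)"
    then have gt: "ereal (?m + C + \<epsilon>) < f z" by simp
    also have "f z \<le> Liminf (at z) f" using lsc by (simp add: lower_semicontinuous_def)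
    finally have "\<forall>\<^sub>F w in at z. ereal (?m + C + \<epsilon>) < f w" by (rule less_LiminfD)
    then have "\<forall>\<^sub>F w in nhds z. ereal (?m + C + \<epsilon>) < f w"
      using gt by (auto simp: eventually_at_filter elim!: eventually_mono)
    then have "\<forall>\<^sub>F n in sequentially. ereal (?m + C + \<epsilon>) < f (y n)"
      using y(1) by (auto simp: filterlim_iff)
    moreover have "\<forall>\<^sub>F n in sequentially. c n < C + \<epsilon>"
      using c(2) \<open>\<epsilon> > 0\<close> by (intro order_tendstoD(2)) auto
    ultimately have "\<forall>\<^sub>F n in sequentially. False"
    proof eventually_elim
      case (elim n)
      then show ?case using c(1)[of n] f_eq_gap[OF y(2)[of n]] by simp
    qed
    then show False by simp
  qed
  show z: "z \<in> dom" using le[of 1] by (auto simp: effective_domain_def intro: le_less_trans)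
  show "gap z \<le> C"
  proof (rule field_le_epsilon)
    fix \<epsilon> :: real assume "\<epsilon> > 0"
    then show "gap z \<le> C + \<epsilon>" using le[of \<epsilon>] f_eq_gap[OF z] by simp
  qed
qed

lemma subdifferential_imp_subgrad:
  assumes "p \<in> subdifferential f y"
  shows "subgrad p y"
proof -
  have le: "f y + ereal (p \<bullet> (w - y)) \<le> f w" for w
    using assms by (simp add: subdifferential_def)
  have y: "y \<in> dom"
    using le[of xmin] min_in_dom by (cases "f y") (auto simp: effective_domain_def)
  moreover have "gap y + p \<bullet> (w - y) \<le> gap w" if "w \<in> dom" for w
    using le[of w] f_eq_gap[OF y] f_eq_gap[OF that] by simp
  ultimately show ?thesis by (simp add: subgrad_def)
qed

lemma subgrad_in_dom: "subgrad p y \<Longrightarrow> y \<in> dom"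
  by (simp add: subgrad_def)

lemma subgradD: "subgrad p y \<Longrightarrow> w \<in> dom \<Longrightarrow> gap y + p \<bullet> (w - y) \<le> gap w"
  by (simp add: subgrad_def)

lemma subgrad_monotone:
  assumes "subgrad p y" "subgrad q z"
  shows "0 \<le> (p - q) \<bullet> (y - z)"
  using subgradD[OF assms(1) subgrad_in_dom[OF assms(2)]]
    subgradD[OF assms(2) subgrad_in_dom[OF assms(1)]]
  by (simp add: inner_diff_left inner_diff_right)

text \<open>
The point \<open>J\<close> minimizes \<open>gap + \<mu> / 2 * norm (- - c)\<^sup>2\<close>. By the parallelogram law every minimizing
sequence is Cauchy, so completeness and lower semicontinuity replace compactness; comparing
\<open>J\<close> with points on the segment to \<open>w\<close> and letting them approach \<open>J\<close> gives the subgradient.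
\<close>

lemma prox_exists:
  assumes "\<mu> > 0"
  shows "\<exists>J. subgrad (\<mu> *\<^sub>R (c - J)) J"
proof -
  define \<Phi> where "\<Phi> y = gap y + \<mu> / 2 * (norm (y - c))\<^sup>2" for y
  have \<Phi>0: "0 \<le> \<Phi> y" if "y \<in> dom" for y
    using gap_nonneg[OF that] assms by (simp add: \<Phi>_def)
  define m where "m = Inf (\<Phi> ` dom)"
  have bdd: "bdd_below (\<Phi> ` dom)" using \<Phi>0 by (auto simp: bdd_below_def)
  have m_le: "m \<le> \<Phi> y" if "y \<in> dom" for y
    unfolding m_def using that bdd by (intro cInf_lower) auto
  have "\<exists>y\<in>dom. \<Phi> y < m + inverse (real (Suc n))" for n
    using cInf_lessD[of "\<Phi> ` dom" "m + inverse (real (Suc n))"] min_in_dom by (auto simp: m_def)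
  then obtain y where y: "\<And>n. y n \<in> dom" "\<And>n. \<Phi> (y n) < m + inverse (real (Suc n))" by metis
  have halves: "P < Q" if "a \<le> c" "b \<le> c" "P \<le> (p + q) / 2 - m" "p < m + a" "q < m + b" "c < Q"
    for a b c p q P Q :: real
    using that by (simp add: field_simps)
  have mid: "\<mu> / 8 * (norm (v - w))\<^sup>2 \<le> (\<Phi> v + \<Phi> w) / 2 - m" if "v \<in> dom" "w \<in> dom" for v w
  proof -
    have "m \<le> \<Phi> ((1/2) *\<^sub>R v + (1/2) *\<^sub>R w)"
      using that by (intro m_le gap_convex) auto
    also have "\<dots> \<le> (gap v + gap w) / 2 + \<mu> / 2 * (norm ((1/2) *\<^sub>R v + (1/2) *\<^sub>R w - c))\<^sup>2"
      using gap_convex(2)[OF that, of "1/2" "1/2"] by (simp add: \<Phi>_def)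
    also have "(norm ((1/2) *\<^sub>R v + (1/2) *\<^sub>R w - c))\<^sup>2
        = (norm (v - c))\<^sup>2 / 2 + (norm (w - c))\<^sup>2 / 2 - (norm (v - w))\<^sup>2 / 4"
      unfolding power2_norm_eq_inner
      by (simp add: inner_diff_left inner_diff_right inner_add_left inner_add_right inner_commute field_simps)
    finally show ?thesis by (simp add: \<Phi>_def field_simps)
  qed
  have "Cauchy y"
  proof (rule metric_CauchyI)
    fix e :: real assume "e > 0"
    then obtain N where N: "inverse (real (Suc N)) < \<mu> / 8 * e\<^sup>2"
      using reals_Archimedean[of "\<mu> / 8 * e\<^sup>2"] assms by auto
    have "dist (y k) (y n) < e" if "k \<ge> N" "n \<ge> N" for k n
    proof -
      have inv: "inverse (real (Suc k)) \<le> inverse (real (Suc N))" "inverse (real (Suc n)) \<le> inverse (real (Suc N))"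
        using that by (auto intro!: le_imp_inverse_le)
      have "\<mu> / 8 * (norm (y k - y n))\<^sup>2 < \<mu> / 8 * e\<^sup>2"
        by (rule halves[OF inv mid[OF y(1)[of k] y(1)[of n]] y(2)[of k] y(2)[of n] N])
      then have "(norm (y k - y n))\<^sup>2 < e\<^sup>2" using assms by simp
      then show ?thesis using \<open>e > 0\<close> by (simp add: dist_norm power2_less_imp_less)
    qed
    then show "\<exists>M. \<forall>m\<ge>M. \<forall>n\<ge>M. dist (y m) (y n) < e" by blast
  qed
  then obtain J where J: "y \<longlonglongrightarrow> J" using Cauchy_convergent by (auto simp: convergent_def)
  have lim: "(\<lambda>n. m + inverse (real (Suc n)) - \<mu> / 2 * (norm (y n - c))\<^sup>2)
      \<longlonglongrightarrow> m + 0 - \<mu> / 2 * (norm (J - c))\<^sup>2"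
    by (intro tendsto_intros J LIMSEQ_inverse_real_of_nat)
  have "gap (y n) \<le> m + inverse (real (Suc n)) - \<mu> / 2 * (norm (y n - c))\<^sup>2" for n
    using y(2)[of n] by (simp add: \<Phi>_def)
  from gap_lsc[OF J y(1) this lim]
  have Jd: "J \<in> dom" and Jm: "gap J + \<mu> / 2 * (norm (J - c))\<^sup>2 \<le> m" by auto
  have "gap J + (\<mu> *\<^sub>R (c - J)) \<bullet> (w - J) \<le> gap w" if w: "w \<in> dom" for w
  proof -
    define K where "K = \<mu> / 2 * (norm (w - J))\<^sup>2"
    have "gap J + (\<mu> *\<^sub>R (c - J)) \<bullet> (w - J) \<le> gap w + \<theta> * K" if \<theta>: "0 < \<theta>" "\<theta> \<le> 1" for \<theta>
    proof -
      have "m \<le> \<Phi> ((1 - \<theta>) *\<^sub>R J + \<theta> *\<^sub>R w)"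
        using \<theta> by (intro m_le gap_convex Jd w) auto
      also have "\<dots> \<le> (1 - \<theta>) * gap J + \<theta> * gap w + \<mu> / 2 * (norm ((1 - \<theta>) *\<^sub>R J + \<theta> *\<^sub>R w - c))\<^sup>2"
        using gap_convex(2)[OF Jd w, of "1 - \<theta>" \<theta>] \<theta> by (simp add: \<Phi>_def)
      also have "(1 - \<theta>) *\<^sub>R J + \<theta> *\<^sub>R w - c = (J - c) + \<theta> *\<^sub>R (w - J)"
        by (simp add: algebra_simps)
      also have "(norm ((J - c) + \<theta> *\<^sub>R (w - J)))\<^sup>2
          = (norm (J - c))\<^sup>2 + 2 * \<theta> * ((J - c) \<bullet> (w - J)) + \<theta>\<^sup>2 * (norm (w - J))\<^sup>2"
        unfolding power2_norm_eq_inner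
        by (simp add: inner_add_left inner_add_right inner_commute power2_eq_square algebra_simps)
      finally have "\<theta> * (gap J) \<le> \<theta> * (gap w + \<mu> * ((J - c) \<bullet> (w - J)) + \<theta> * K)"
        using Jm by (simp add: K_def algebra_simps power2_eq_square)
      then have "gap J \<le> gap w + \<mu> * ((J - c) \<bullet> (w - J)) + \<theta> * K" using \<theta> by simp
      moreover have "(\<mu> *\<^sub>R (c - J)) \<bullet> (w - J) = - (\<mu> * ((J - c) \<bullet> (w - J)))"
        by (simp add: inner_diff_left algebra_simps)
      ultimately show ?thesis by linarith
    qed
    then have "gap J + (\<mu> *\<^sub>R (c - J)) \<bullet> (w - J) \<le> gap w + inverse (real (Suc n)) * K" for n
      by (simp add: inverse_le_1_iff)
    moreover have "(\<lambda>n. gap w + inverse (real (Suc n)) * K) \<longlonglongrightarrow> gap w + 0 * K"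
      by (intro tendsto_intros LIMSEQ_inverse_real_of_nat)
    ultimately show ?thesis using LIMSEQ_le_const by fastforce
  qed
  then show ?thesis using Jd by (auto simp: subgrad_def)
qed

section \<open>The Tikhonov path\<close>

definition tikhonov :: "real \<Rightarrow> 'a" where
  "tikhonov e = (SOME y. subgrad (- (e *\<^sub>R y)) y)"

lemma tikhonov_subgrad:
  assumes "e > 0"
  shows "subgrad (- (e *\<^sub>R tikhonov e)) (tikhonov e)"
proof -
  have "\<exists>y. subgrad (- (e *\<^sub>R y)) y"
    using prox_exists[OF assms, of 0] by simp
  then show ?thesis unfolding tikhonov_def by (rule someI_ex)
qed

lemma tikhonov_in_dom: "e > 0 \<Longrightarrow> tikhonov e \<in> dom"
  using tikhonov_subgrad subgrad_in_dom by blast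

text \<open>
The minimality of \<open>tikhonov e\<close>, strengthened by the quadratic growth that the strong
convexity of the regularized function provides.
\<close>

lemma tikhonov_min_ineq:
  assumes "e > 0" "w \<in> dom"
  shows "gap (tikhonov e) + e / 2 * (norm (tikhonov e))\<^sup>2 + e / 2 * (norm (w - tikhonov e))\<^sup>2
           \<le> gap w + e / 2 * (norm w)\<^sup>2"
proof -
  have "gap (tikhonov e) - e * (tikhonov e \<bullet> (w - tikhonov e)) \<le> gap w"
    using subgradD[OF tikhonov_subgrad[OF assms(1)] assms(2)] by simp
  moreover have "(norm w)\<^sup>2 = (norm (tikhonov e))\<^sup>2 + 2 * (tikhonov e \<bullet> (w - tikhonov e)) + (norm (w - tikhonov e))\<^sup>2"
    unfolding power2_norm_eq_inner by (simp add: inner_diff_left inner_diff_right inner_commute)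
  then have "e / 2 * (norm w)\<^sup>2 = e / 2 * (norm (tikhonov e))\<^sup>2 + e * (tikhonov e \<bullet> (w - tikhonov e))
      + e / 2 * (norm (w - tikhonov e))\<^sup>2"
    by (simp add: distrib_left)
  ultimately show ?thesis by linarith
qed

lemma tikhonov_vs_min:
  assumes "e > 0"
  shows "gap (tikhonov e) / e + (norm (tikhonov e))\<^sup>2 / 2 + (norm (xmin - tikhonov e))\<^sup>2 / 2 \<le> (norm xmin)\<^sup>2 / 2"
proof -
  have "e * (gap (tikhonov e) / e + (norm (tikhonov e))\<^sup>2 / 2 + (norm (xmin - tikhonov e))\<^sup>2 / 2)
      \<le> e * ((norm xmin)\<^sup>2 / 2)"
    using tikhonov_min_ineq[OF assms min_in_dom] assms by (simp add: gap_min algebra_simps)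
  then show ?thesis using assms by (simp only: mult_le_cancel_left_pos)
qed

lemma tikhonov_gap_nonneg: "e > 0 \<Longrightarrow> 0 \<le> gap (tikhonov e)"
  by (intro gap_nonneg tikhonov_in_dom)

lemma tikhonov_norm_le:
  assumes "e > 0"
  shows "norm (tikhonov e) \<le> norm xmin"
proof -
  have "0 \<le> gap (tikhonov e) / e" using tikhonov_gap_nonneg[OF assms] assms by simp
  moreover have "0 \<le> (norm (xmin - tikhonov e))\<^sup>2 / 2" by simp
  ultimately have "(norm (tikhonov e))\<^sup>2 \<le> (norm xmin)\<^sup>2" using tikhonov_vs_min[OF assms] by linarith
  then show ?thesis by (simp add: power2_le_iff_abs_le)
qed

lemma tikhonov_gap_le:
  assumes "e > 0"
  shows "gap (tikhonov e) \<le> e * ((norm xmin)\<^sup>2 / 2)"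
proof -
  have "gap (tikhonov e) / e \<le> (norm xmin)\<^sup>2 / 2"
    using tikhonov_vs_min[OF assms] zero_le_power2[of "norm (tikhonov e)"] zero_le_power2[of "norm (xmin - tikhonov e)"]
    by linarith
  then show ?thesis using assms by (simp add: pos_divide_le_eq mult.commute)
qed

text \<open>
Monotonicity of the subdifferential applied to the two points of the path.
\<close>

lemma tikhonov_Lipschitz:
  assumes "e1 > 0" "e2 > 0"
  shows "e1 * norm (tikhonov e1 - tikhonov e2) \<le> \<bar>e1 - e2\<bar> * norm xmin"
proof (cases "tikhonov e1 = tikhonov e2")
  case False
  let ?d = "tikhonov e1 - tikhonov e2"
  have "0 \<le> (- (e1 *\<^sub>R tikhonov e1) - - (e2 *\<^sub>R tikhonov e2)) \<bullet> ?d"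
    by (intro subgrad_monotone tikhonov_subgrad assms)
  also have "- (e1 *\<^sub>R tikhonov e1) - - (e2 *\<^sub>R tikhonov e2) = (e2 - e1) *\<^sub>R tikhonov e2 - e1 *\<^sub>R ?d"
    by (simp add: algebra_simps)
  finally have "e1 * (norm ?d)\<^sup>2 \<le> (e2 - e1) * (tikhonov e2 \<bullet> ?d)"
    by (simp add: inner_diff_left power2_norm_eq_inner)
  also have "\<dots> \<le> \<bar>e1 - e2\<bar> * (norm xmin * norm ?d)"
  proof -
    have "\<bar>tikhonov e2 \<bullet> ?d\<bar> \<le> norm xmin * norm ?d"
      using Cauchy_Schwarz_ineq2[of "tikhonov e2" ?d] tikhonov_norm_le[OF assms(2)]
      by (meson mult_right_mono norm_ge_zero order_trans)
    then have "\<bar>e2 - e1\<bar> * \<bar>tikhonov e2 \<bullet> ?d\<bar> \<le> \<bar>e2 - e1\<bar> * (norm xmin * norm ?d)"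
      by (intro mult_left_mono) auto
    moreover have "(e2 - e1) * (tikhonov e2 \<bullet> ?d) \<le> \<bar>e2 - e1\<bar> * \<bar>tikhonov e2 \<bullet> ?d\<bar>"
      by (metis abs_ge_self abs_mult)
    ultimately show ?thesis by (simp only: abs_minus_commute)
  qed
  finally have "norm ?d * (e1 * norm ?d) \<le> norm ?d * (\<bar>e1 - e2\<bar> * norm xmin)"
    by (simp add: power2_eq_square algebra_simps)
  then show ?thesis using False by simp
qed simp

text \<open>
This inequality makes the path Cauchy as \<open>e\<close> decreases to zero: the norms increase and are
bounded, so no weak compactness is needed.
\<close>

lemma tikhonov_norm_diff:
  assumes "0 < e1" "e1 \<le> e2"
  shows "(norm (tikhonov e1 - tikhonov e2))\<^sup>2 \<le> (norm (tikhonov e1))\<^sup>2 - (norm (tikhonov e2))\<^sup>2"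
proof (cases "e1 = e2")
  case False
  let ?d = "tikhonov e1 - tikhonov e2"
  have "0 \<le> (- (e1 *\<^sub>R tikhonov e1) - - (e2 *\<^sub>R tikhonov e2)) \<bullet> ?d"
    using assms by (intro subgrad_monotone tikhonov_subgrad) auto
  also have "- (e1 *\<^sub>R tikhonov e1) - - (e2 *\<^sub>R tikhonov e2) = (e2 - e1) *\<^sub>R tikhonov e2 - e1 *\<^sub>R ?d"
    by (simp add: algebra_simps)
  finally have "e1 * (norm ?d)\<^sup>2 \<le> (e2 - e1) * (tikhonov e2 \<bullet> ?d)"
    by (simp add: inner_diff_left power2_norm_eq_inner)
  then have "0 \<le> (e2 - e1) * (tikhonov e2 \<bullet> ?d)"
    using assms by (smt (verit) mult_nonneg_nonneg zero_le_power2)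
  then have "0 \<le> tikhonov e2 \<bullet> ?d" using assms False by (simp add: zero_le_mult_iff)
  then show ?thesis
    unfolding power2_norm_eq_inner by (simp add: inner_diff_left inner_diff_right inner_commute)
qed simp

text \<open>
Along \<open>e = 1 / (n + 1)\<close> the path converges to some minimizer \<open>L\<close>. Since \<open>norm xmin \<le> norm L\<close>
by the choice of \<open>xmin\<close>, lemma \<open>tikhonov_vs_min\<close> bounds the squared distance to \<open>xmin\<close>
by \<open>(norm xmin)\<^sup>2 - (norm (tikhonov e))\<^sup>2\<close>, and monotonicity of the norms extends this from the
sequence to all small \<open>e\<close>.
\<close>

lemma tikhonov_tendsto: "(tikhonov \<longlongrightarrow> xmin) (at_right 0)"
proof -
  define e where "e n = inverse (real (Suc n))" for n
  have e0: "e n > 0" for n by (simp add: e_def)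
  define a where "a n = tikhonov (e n)" for n
  have e_anti: "e k \<le> e n" if "n \<le> k" for n k
    using that by (auto simp: e_def intro!: le_imp_inverse_le)
  have diff: "(norm (a k - a n))\<^sup>2 \<le> (norm (a k))\<^sup>2 - (norm (a n))\<^sup>2" if "n \<le> k" for n k
    unfolding a_def by (rule tikhonov_norm_diff[OF e0 e_anti[OF that]])
  have "incseq (\<lambda>n. (norm (a n))\<^sup>2)"
  proof (rule incseq_SucI)
    show "(norm (a n))\<^sup>2 \<le> (norm (a (Suc n)))\<^sup>2" for n
      using diff[of n "Suc n"] zero_le_power2[of "norm (a (Suc n) - a n)"] by linarith
  qed
  moreover have "\<forall>n. (norm (a n))\<^sup>2 \<le> (norm xmin)\<^sup>2"
    using tikhonov_norm_le[OF e0] by (auto simp: a_def intro: power_mono)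
  ultimately obtain l where l: "(\<lambda>n. (norm (a n))\<^sup>2) \<longlonglongrightarrow> l"
    using incseq_convergent by metis
  have "Cauchy a"
  proof (rule metric_CauchyI)
    fix d :: real assume "d > 0"
    have "Cauchy (\<lambda>n. (norm (a n))\<^sup>2)" using l by (rule LIMSEQ_imp_Cauchy)
    then obtain M where M: "\<And>k n. k \<ge> M \<Longrightarrow> n \<ge> M \<Longrightarrow> dist ((norm (a k))\<^sup>2) ((norm (a n))\<^sup>2) < d\<^sup>2"
      using metric_CauchyD[of "\<lambda>n. (norm (a n))\<^sup>2" "d\<^sup>2"] \<open>d > 0\<close> by (metis zero_less_power)
    have wlog: "dist (a k) (a n) < d" if "M \<le> n" "n \<le> k" for k n
    proof -
      have "(norm (a k - a n))\<^sup>2 < d\<^sup>2"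
        using diff[OF that(2)] M[of k n] that by (simp add: dist_real_def)
      then show ?thesis using \<open>d > 0\<close> by (simp add: dist_norm power2_less_imp_less)
    qed
    have "dist (a k) (a n) < d" if "k \<ge> M" "n \<ge> M" for k n
      using wlog[of n k] wlog[of k n] that by (cases "n \<le> k") (auto simp: dist_commute)
    then show "\<exists>M. \<forall>m\<ge>M. \<forall>n\<ge>M. dist (a m) (a n) < d" by blast
  qed
  then obtain L where L: "a \<longlonglongrightarrow> L" using Cauchy_convergent by (auto simp: convergent_def)
  have lim0: "(\<lambda>n. e n * ((norm xmin)\<^sup>2 / 2)) \<longlonglongrightarrow> 0 * ((norm xmin)\<^sup>2 / 2)"
    unfolding e_def by (intro tendsto_intros LIMSEQ_inverse_real_of_nat)
  have Ld: "L \<in> dom" and "gap L \<le> 0 * ((norm xmin)\<^sup>2 / 2)"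
    using gap_lsc[OF L _ _ lim0] tikhonov_in_dom[OF e0] tikhonov_gap_le[OF e0] by (auto simp: a_def)
  then have "f L = f xmin"
    using gap_nonneg[OF Ld] f_eq_gap[OF Ld] f_eq_gap[OF min_in_dom] by (simp add: gap_min)
  then have "L \<in> argmin_set f"
    using f_min_le by (auto simp: argmin_set_def is_arg_min_def not_less)
  then have "norm xmin \<le> norm L" using min_norm by (auto simp: is_arg_min_def not_less)
  moreover have "(\<lambda>n. norm (a n)) \<longlonglongrightarrow> norm L" using L by (rule tendsto_norm)
  ultimately have lim: "(\<lambda>n. (norm xmin)\<^sup>2 - (norm (a n))\<^sup>2) \<longlonglongrightarrow> (norm xmin)\<^sup>2 - (norm L)\<^sup>2"
    and neg: "(norm xmin)\<^sup>2 - (norm L)\<^sup>2 \<le> 0"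
    by (auto intro!: tendsto_intros power_mono)
  show ?thesis
  proof (rule tendstoI)
    fix d :: real assume "d > 0"
    then have "(norm xmin)\<^sup>2 - (norm L)\<^sup>2 < d\<^sup>2" using neg by (smt (verit) zero_less_power)
    from order_tendstoD(2)[OF lim this] obtain n where n: "(norm xmin)\<^sup>2 - (norm (a n))\<^sup>2 < d\<^sup>2"
      by (auto simp: eventually_sequentially)
    have "dist (tikhonov s) xmin < d" if s: "0 < s" "s < e n" for s
    proof -
      have "0 \<le> (norm (tikhonov s - a n))\<^sup>2" by simp
      also have "\<dots> \<le> (norm (tikhonov s))\<^sup>2 - (norm (a n))\<^sup>2"
        unfolding a_def using s by (intro tikhonov_norm_diff) auto
      finally have "(norm (a n))\<^sup>2 \<le> (norm (tikhonov s))\<^sup>2" by simp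
      moreover have "0 \<le> gap (tikhonov s) / s" using tikhonov_gap_nonneg s by simp
      ultimately have "(norm (xmin - tikhonov s))\<^sup>2 < d\<^sup>2" using tikhonov_vs_min[OF s(1)] n by linarith
      then show ?thesis using \<open>d > 0\<close> by (simp add: dist_norm norm_minus_commute power2_less_imp_less)
    qed
    then show "\<forall>\<^sub>F s in at_right 0. dist (tikhonov s) xmin < d"
      using e0[of n] by (auto simp: eventually_at_right_field)
  qed
qed

text \<open>
The regularized excess \<open>min (gap + e / 2 * norm\<^sup>2)\<close> divided by \<open>e\<close>.
\<close>

definition tikhonov_value :: "real \<Rightarrow> real" where
  "tikhonov_value e = gap (tikhonov e) / e + (norm (tikhonov e))\<^sup>2 / 2"

lemma tikhonov_value_le: "e > 0 \<Longrightarrow> tikhonov_value e \<le> (norm xmin)\<^sup>2 / 2"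
  using tikhonov_vs_min[of e] zero_le_power2[of "norm (xmin - tikhonov e)"] unfolding tikhonov_value_def by linarith

text \<open>
As a function of \<open>1 / e\<close> the value is an infimum of the affine functions
\<open>y \<mapsto> gap y * (1 / e) + norm y\<^sup>2 / 2\<close>, hence concave, and the excess at the minimizer is a
supergradient. This is what makes the excess along the path integrable.
\<close>

lemma tikhonov_value_diff_ge:
  assumes "e1 > 0" "e2 > 0"
  shows "gap (tikhonov e2) * (1 / e2 - 1 / e1) \<le> tikhonov_value e2 - tikhonov_value e1"
proof -
  have "gap (tikhonov e1) + e1 / 2 * (norm (tikhonov e1))\<^sup>2 \<le> gap (tikhonov e2) + e1 / 2 * (norm (tikhonov e2))\<^sup>2"
    using tikhonov_min_ineq[OF assms(1) tikhonov_in_dom[OF assms(2)]] assms(1)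
      zero_le_power2[of "norm (tikhonov e2 - tikhonov e1)"] by (smt (verit) mult_nonneg_nonneg divide_nonneg_pos)
  then have "(gap (tikhonov e1) + e1 / 2 * (norm (tikhonov e1))\<^sup>2) / e1
      \<le> (gap (tikhonov e2) + e1 / 2 * (norm (tikhonov e2))\<^sup>2) / e1"
    using assms(1) by (simp add: divide_right_mono)
  then show ?thesis using assms by (simp add: tikhonov_value_def add_divide_distrib right_diff_distrib)
qed

end

section \<open>The trajectory and its distance to the Tikhonov path\<close>

text \<open>
The parameter \<open>\<kappa>\<close> stands for \<open>\<alpha> - 1\<close>, the exponent of the weight that turns the equation for \<open>x\<close>
into a statement on averages of \<open>v\<close>.
\<close>

locale trajectory = convex_minimum f xmin
  for f :: "'a::{real_inner, complete_space} \<Rightarrow> ereal" and xmin :: 'a +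
  fixes r \<kappa> t0 :: real and x0 :: 'a and v x :: "real \<Rightarrow> 'a"
  assumes r: "0 < r" "r < 1" and \<kappa>: "0 < \<kappa>" and t0: "0 < t0"
    and x0: "x0 \<in> effective_domain f" and init: "v t0 = x0" "x t0 = x0"
    and sol: "strong_solution f r (\<kappa> + 1) t0 v x"
begin

text \<open>
The constant in front of the last term of the system for \<open>v\<close>; lemma \<open>eps_rate\<close> relates it
to the Tikhonov coefficient \<open>eps\<close>.
\<close>

definition damping :: real where "damping = 2 powr r * \<kappa> powr (r - 1)"

definition eps :: "real \<Rightarrow> real" where "eps t = \<kappa> * damping * t powr (- 2 * r)"

definition X :: "real \<Rightarrow> 'a" where "X t = tikhonov (eps t)"

definition d :: "real \<Rightarrow> 'a" where "d t = v t - X t"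

definition u :: "real \<Rightarrow> real" where "u t = (norm (d t))\<^sup>2 / 2"

definition solves_at :: "real \<Rightarrow> 'a \<Rightarrow> bool" where
  "solves_at t p \<longleftrightarrow> t0 < t \<and> subgrad p (v t)
     \<and> (v has_vector_derivative - ((t / \<kappa>) *\<^sub>R (p + eps t *\<^sub>R v t))) (at t)
     \<and> (x has_vector_derivative - ((\<kappa> / t) *\<^sub>R (x t - v t))) (at t)"

text \<open>
The derivative of \<open>u\<close> at a point where the system holds with subgradient \<open>p\<close>, except that
the contribution of the motion of \<open>X\<close> is replaced by its upper bound: the path has speed at
most \<open>2 r / t * norm xmin\<close>.
\<close>

definition u_slope :: "real \<Rightarrow> 'a \<Rightarrow> real" where
  "u_slope t p = - (t / \<kappa>) * ((p + eps t *\<^sub>R v t) \<bullet> d t) + 2 * r * norm xmin / t * norm (d t)"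

lemma damping_pos: "0 < damping"
  using \<kappa> by (simp add: damping_def)

lemma eps_pos: "0 < t \<Longrightarrow> 0 < eps t"
  using \<kappa> damping_pos by (simp add: eps_def)

lemma eps_rate: "0 < t \<Longrightarrow> t / \<kappa> * eps t = damping * t powr (1 - 2 * r)"
  using \<kappa> powr_mult_base[of t "- 2 * r"] by (simp add: eps_def)

lemma eps_deriv:
  assumes "0 < t"
  shows "(eps has_real_derivative - (2 * r / t) * eps t) (at t)"
proof -
  have "(eps has_real_derivative \<kappa> * damping * (- 2 * r * t powr (- 2 * r - 1))) (at t)"
    unfolding eps_def [abs_def]
    by (intro DERIV_cmult has_real_derivative_powr assms)
  moreover have "t powr (- 2 * r - 1) = t powr (- 2 * r) / t"
    using assms by (simp add: powr_diff)
  ultimately show ?thesis by (simp add: eps_def mult_ac)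
qed

lemma X_diff:
  assumes "0 < s" "0 < t"
  shows "norm (X s - X t) \<le> \<bar>eps s - eps t\<bar> / eps t * norm xmin"
proof -
  have "eps t * norm (X s - X t) \<le> \<bar>eps s - eps t\<bar> * norm xmin"
    using tikhonov_Lipschitz[OF eps_pos[OF assms(2)] eps_pos[OF assms(1)]]
    by (simp add: X_def norm_minus_commute abs_minus_commute)
  then show ?thesis using eps_pos[OF assms(2)] by (simp add: pos_le_divide_eq mult.commute)
qed

lemma X_Lipschitz:
  assumes "0 < a"
  obtains C where "C \<ge> 0"
    "\<And>s t. s \<in> {a..b} \<Longrightarrow> t \<in> {a..b} \<Longrightarrow> norm (X t - X s) \<le> C * \<bar>t - s\<bar>"
proof -
  obtain L where L: "L \<ge> 0"
    "\<And>s t. s \<in> {a..b} \<Longrightarrow> t \<in> {a..b} \<Longrightarrow> \<bar>t powr (- 2 * r) - s powr (- 2 * r)\<bar> \<le> L * \<bar>t - s\<bar>"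
    using powr_Lipschitz[OF assms, of b "- 2 * r"] by auto
  define C where "C = \<kappa> * damping * L / eps b * norm xmin"
  have bound: "norm (X t - X s) \<le> C * \<bar>t - s\<bar>" if st: "s \<in> {a..b}" "t \<in> {a..b}" for s t
  proof -
    have pos: "0 < s" "0 < t" "0 < b" using st assms by auto
    have "eps b \<le> eps s"
      using st pos r \<kappa> damping_pos by (auto simp: eps_def intro!: mult_left_mono powr_mono2')
    have "\<bar>eps t - eps s\<bar> = \<kappa> * damping * \<bar>t powr (- 2 * r) - s powr (- 2 * r)\<bar>"
      using \<kappa> damping_pos by (simp add: eps_def right_diff_distrib[symmetric] abs_mult)
    also have "\<dots> \<le> \<kappa> * damping * (L * \<bar>t - s\<bar>)"
      using \<kappa> damping_pos by (intro mult_left_mono L(2)[OF st]) auto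
    finally have "\<bar>eps t - eps s\<bar> / eps s \<le> \<kappa> * damping * (L * \<bar>t - s\<bar>) / eps b"
      using \<open>eps b \<le> eps s\<close> eps_pos[OF pos(3)] \<kappa> damping_pos L(1) by (intro frac_le) auto
    then have "\<bar>eps t - eps s\<bar> / eps s * norm xmin \<le> \<kappa> * damping * (L * \<bar>t - s\<bar>) / eps b * norm xmin"
      by (intro mult_right_mono) auto
    with X_diff[OF pos(2,1)] have "norm (X t - X s) \<le> \<kappa> * damping * (L * \<bar>t - s\<bar>) / eps b * norm xmin"
      by (rule order_trans)
    also have "\<dots> = C * \<bar>t - s\<bar>" by (simp add: C_def)
    finally show ?thesis .
  qed
  show thesis
  proof (cases "a \<le> b")
    case True
    then have "C \<ge> 0" using assms eps_pos[of b] \<kappa> damping_pos L(1) by (auto simp: C_def)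
    then show ?thesis using bound by (rule that)
  qed (auto intro: that[of 0])
qed

lemma X_continuous_on: "continuous_on {t0..b} X"
proof -
  obtain C where "C \<ge> 0"
    "\<And>s t. s \<in> {t0..b} \<Longrightarrow> t \<in> {t0..b} \<Longrightarrow> norm (X t - X s) \<le> C * \<bar>t - s\<bar>"
    using X_Lipschitz[OF t0, of b] by auto
  then show ?thesis by (intro lipschitz_imp_continuous_on)
qed

lemma X_ac: "t0 \<le> a \<Longrightarrow> absolutely_continuous_fun_on {a..b} X"
proof -
  assume "t0 \<le> a"
  then have "0 < a" using t0 by simp
  then obtain C where "C \<ge> 0" and C:
    "\<And>s t. s \<in> {a..b} \<Longrightarrow> t \<in> {a..b} \<Longrightarrow> norm (X t - X s) \<le> C * \<bar>t - s\<bar>"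
    by (rule X_Lipschitz[of a b]) auto
  show ?thesis
  proof (rule ac_Lipschitz)
    show "norm (X t - X s) \<le> C * (t - s)" if "s \<in> {a..b}" "t \<in> {a..b}" "s \<le> t" for s t
      using C[OF that(1,2)] that(3) by simp
  qed
qed

lemma v_continuous_on: "continuous_on {t0..b} v"
  and x_continuous_on: "continuous_on {t0..b} x"
  using sol unfolding strong_solution_def by (auto intro: continuous_on_subset)

lemma v_ac: "t0 \<le> a \<Longrightarrow> absolutely_continuous_fun_on {a..b} v"
  and x_ac: "t0 \<le> a \<Longrightarrow> absolutely_continuous_fun_on {a..b} x"
proof -
  have *: "absolutely_continuous_fun_on {a..b} v \<and> absolutely_continuous_fun_on {a..b} x"
    if a: "t0 \<le> a" for a
  proof (cases "a \<le> b")
    case True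
    then show ?thesis using sol a unfolding strong_solution_def by blast
  next
    case False
    then show ?thesis by (auto intro!: ac_Lipschitz)
  qed
  show "t0 \<le> a \<Longrightarrow> absolutely_continuous_fun_on {a..b} v"
    and "t0 \<le> a \<Longrightarrow> absolutely_continuous_fun_on {a..b} x" using * by auto
qed

lemma d_continuous_on: "continuous_on {t0..b} d"
  unfolding d_def by (intro continuous_intros v_continuous_on X_continuous_on)

lemma u_eq: "u t = (1/2) * (d t \<bullet> d t)"
  by (simp add: u_def power2_norm_eq_inner)

lemma u_continuous_on: "continuous_on {t0..b} u"
  unfolding u_def by (intro continuous_intros d_continuous_on) auto

lemma u_ac:
  assumes "t0 \<le> a"
  shows "absolutely_continuous_fun_on {a..b} u"
proof -
  have c: "continuous_on {a..b} d"
    by (rule continuous_on_subset[OF d_continuous_on]) (use assms in auto)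
  have "absolutely_continuous_fun_on {a..b} d"
    unfolding d_def by (intro ac_diff v_ac X_ac assms)
  then have "absolutely_continuous_fun_on {a..b} (\<lambda>t. d t \<bullet> d t)"
    by (intro ac_inner c)
  then have "absolutely_continuous_fun_on {a..b} (\<lambda>t. (1/2) * (d t \<bullet> d t))"
    by (rule ac_cmult)
  then show ?thesis by (simp add: u_eq[abs_def])
qed

lemma ae_solves_at: "AE t in lborel. t0 < t \<longrightarrow> (\<exists>p. solves_at t p)"
proof -
  have "AE t in lborel. t0 \<le> t \<longrightarrow>
        (\<exists>v' x'. (v has_vector_derivative v') (at t within {t0..}) \<and>
           (x has_vector_derivative x') (at t within {t0..}) \<and>
           (\<exists>p\<in>subdifferential f (v t).
              v' + (t / \<kappa>) *\<^sub>R p + (damping / t powr (2 * r - 1)) *\<^sub>R v t = 0) \<and>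
           x' + (\<kappa> / t) *\<^sub>R (x t - v t) = 0)"
    using sol unfolding strong_solution_def damping_def by simp
  then show ?thesis
  proof eventually_elim
    case (elim t)
    show ?case
    proof
      assume t: "t0 < t"
      with elim obtain v' x' p where
        der: "(v has_vector_derivative v') (at t within {t0..})"
          "(x has_vector_derivative x') (at t within {t0..})"
        and p: "p \<in> subdifferential f (v t)"
        and eq: "v' + (t / \<kappa>) *\<^sub>R p + (damping / t powr (2 * r - 1)) *\<^sub>R v t = 0"
          "x' + (\<kappa> / t) *\<^sub>R (x t - v t) = 0" by auto
      have at: "at t within {t0..} = at t"
        using t by (intro at_within_interior) auto
      have "damping / t powr (2 * r - 1) = t / \<kappa> * eps t"
        using t t0 eps_rate[of t] by (simp add: powr_diff)
      then have "v' + ((t / \<kappa>) *\<^sub>R (p + eps t *\<^sub>R v t)) = 0"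
        using eq(1) by (simp add: scaleR_add_right add.assoc)
      then have "v' = - ((t / \<kappa>) *\<^sub>R (p + eps t *\<^sub>R v t))"
        by (simp add: eq_neg_iff_add_eq_0)
      moreover have "x' = - ((\<kappa> / t) *\<^sub>R (x t - v t))"
        using eq(2) by (simp add: eq_neg_iff_add_eq_0)
      ultimately have "solves_at t p"
        using t der subdifferential_imp_subgrad[OF p] by (simp add: solves_at_def at)
      then show "\<exists>p. solves_at t p" ..
    qed
  qed
qed

text \<open>
The increment of \<open>u\<close> is the inner product of the increment of \<open>d\<close> with the mean of \<open>d\<close> at the
two ends. In this product \<open>v\<close> contributes through its derivative and \<open>X\<close> through its Lipschitz
estimate, which suffices without a derivative.
\<close>

lemma u_upper_slope:
  assumes "solves_at t p"
  shows "upper_slope_le u t (u_slope t p)"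
proof -
  have t: "0 < t" "t0 < t" using assms t0 by (auto simp: solves_at_def)
  define v' where "v' = - ((t / \<kappa>) *\<^sub>R (p + eps t *\<^sub>R v t))"
  have v': "(v has_vector_derivative v') (at t)" using assms by (simp add: solves_at_def v'_def)
  have q: "((\<lambda>s. (1 / (s - t)) *\<^sub>R (v s - v t)) \<longlongrightarrow> v') (at t)"
  proof -
    have "((\<lambda>s. (1 / norm (s - t)) *\<^sub>R (v s - (v t + (s - t) *\<^sub>R v'))) \<longlongrightarrow> 0) (at t)"
      using v' by (simp add: has_vector_derivative_def has_derivative_at2)
    then have "((\<lambda>s. norm ((1 / norm (s - t)) *\<^sub>R (v s - (v t + (s - t) *\<^sub>R v')))) \<longlongrightarrow> 0) (at t)"
      by (rule tendsto_norm_zero)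
    moreover have "\<forall>\<^sub>F s in at t. norm ((1 / norm (s - t)) *\<^sub>R (v s - (v t + (s - t) *\<^sub>R v')))
        = norm ((1 / (s - t)) *\<^sub>R (v s - v t) - v')"
      unfolding eventually_at_filter
    proof (intro always_eventually allI impI)
      fix s assume "s \<noteq> t"
      then have "(1 / (s - t)) *\<^sub>R (v s - v t) - v' = (1 / (s - t)) *\<^sub>R (v s - (v t + (s - t) *\<^sub>R v'))"
        by (simp add: scaleR_diff_right scaleR_add_right)
      then show "norm ((1 / norm (s - t)) *\<^sub>R (v s - (v t + (s - t) *\<^sub>R v')))
        = norm ((1 / (s - t)) *\<^sub>R (v s - v t) - v')" by simp
    qed
    ultimately have "((\<lambda>s. norm ((1 / (s - t)) *\<^sub>R (v s - v t) - v')) \<longlongrightarrow> 0) (at t)"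
      by (rule Lim_transform_eventually)
    then have "((\<lambda>s. (1 / (s - t)) *\<^sub>R (v s - v t) - v') \<longlongrightarrow> 0) (at t)"
      by (rule tendsto_norm_zero_cancel)
    then show ?thesis by (rule LIM_zero_cancel)
  qed
  have "t \<in> interior {t0..t+1}" using t by (simp add: interior_atLeastAtMost_real)
  then have "isCont d t"
    using continuous_on_interior[OF d_continuous_on] by blast
  then have dlim: "(d \<longlongrightarrow> d t) (at t)" by (simp add: isCont_def)
  have elim: "((\<lambda>s. (eps s - eps t) / (s - t)) \<longlongrightarrow> - (2 * r / t) * eps t) (at t)"
    using eps_deriv[OF t(1)] by (simp add: has_field_derivative_iff)
  define B where "B s = ((1 / (s - t)) *\<^sub>R (v s - v t)) \<bullet> ((1/2) *\<^sub>R (d s + d t))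
      + \<bar>(eps s - eps t) / (s - t)\<bar> / eps t * norm xmin * norm ((1/2) *\<^sub>R (d s + d t))" for s
  have "(B \<longlongrightarrow> v' \<bullet> ((1/2) *\<^sub>R (d t + d t))
      + \<bar>- (2 * r / t) * eps t\<bar> / eps t * norm xmin * norm ((1/2) *\<^sub>R (d t + d t))) (at t)"
    unfolding B_def by (intro tendsto_intros q dlim elim) (use eps_pos[OF t(1)] in auto)
  moreover have "(1/2) *\<^sub>R (d t + d t) = d t" by (simp add: scaleR_2[symmetric])
  moreover have "\<bar>- (2 * r / t) * eps t\<bar> / eps t = 2 * r / t"
    using eps_pos[OF t(1)] t(1) r by (simp add: abs_mult)
  ultimately have "(B \<longlongrightarrow> v' \<bullet> d t + 2 * r / t * norm xmin * norm (d t)) (at t)"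
    by (simp only:)
  moreover have "u_slope t p = v' \<bullet> d t + 2 * r / t * norm xmin * norm (d t)"
    by (simp add: u_slope_def v'_def)
  ultimately have "(B \<longlongrightarrow> u_slope t p) (at t)" by (simp only:)
  moreover have "\<forall>\<^sub>F s in at t. (u s - u t) / (s - t) \<le> B s"
  proof -
    have "\<forall>\<^sub>F s in at t. 0 < s" using order_tendstoD(1)[OF tendsto_ident_at t(1)] .
    moreover have "\<forall>\<^sub>F s in at t. s \<noteq> t" by (auto simp: eventually_at_filter)
    ultimately show ?thesis
    proof eventually_elim
      case (elim s)
      let ?m = "(1/2) *\<^sub>R (d s + d t)"
      have "u s - u t = (d s - d t) \<bullet> ?m"
        by (simp add: u_eq inner_diff_left inner_add_right inner_commute[of "d t" "d s"] algebra_simps)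
      also have "d s - d t = (v s - v t) - (X s - X t)" by (simp add: d_def)
      finally have "(u s - u t) / (s - t)
          = ((1 / (s - t)) *\<^sub>R (v s - v t)) \<bullet> ?m - ((X s - X t) \<bullet> ?m) / (s - t)"
        by (simp only: inner_diff_left[of "v s - v t"] diff_divide_distrib inner_scaleR_left
            times_divide_eq_left mult_1)
      moreover have "- (((X s - X t) \<bullet> ?m) / (s - t))
          \<le> \<bar>(eps s - eps t) / (s - t)\<bar> / eps t * norm xmin * norm ?m"
      proof -
        have "- (((X s - X t) \<bullet> ?m) / (s - t)) \<le> \<bar>(X s - X t) \<bullet> ?m\<bar> / \<bar>s - t\<bar>"
          by (metis abs_divide abs_ge_minus_self)
        also have "\<dots> \<le> (norm (X s - X t) * norm ?m) / \<bar>s - t\<bar>"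
          by (intro divide_right_mono Cauchy_Schwarz_ineq2) auto
        also have "\<dots> \<le> (\<bar>eps s - eps t\<bar> / eps t * norm xmin * norm ?m) / \<bar>s - t\<bar>"
          using X_diff[OF elim(1) t(1)] by (intro divide_right_mono mult_right_mono) auto
        finally show ?thesis by (simp add: abs_divide mult_ac)
      qed
      ultimately show ?case unfolding B_def by linarith
    qed
  qed
  ultimately show ?thesis by (intro upper_slope_leI)
qed

text \<open>
The regularized subdifferential is strongly monotone with modulus \<open>eps t\<close>, and \<open>X t\<close> is its zero.
\<close>

lemma u_slope_le_contraction:
  assumes "solves_at t p"
  shows "u_slope t p \<le> - (damping * t powr (1 - 2 * r)) * (norm (d t))\<^sup>2 + 2 * r * norm xmin / t * norm (d t)"
proof -
  have t: "0 < t" and p: "subgrad p (v t)" using assms t0 by (auto simp: solves_at_def)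
  have "0 \<le> (p - - (eps t *\<^sub>R X t)) \<bullet> (v t - X t)"
    unfolding X_def by (intro subgrad_monotone p tikhonov_subgrad eps_pos t)
  then have "eps t * (d t \<bullet> d t) \<le> (p + eps t *\<^sub>R v t) \<bullet> d t"
    by (simp add: d_def inner_diff_left inner_diff_right inner_add_left algebra_simps)
  then have "t / \<kappa> * (eps t * (d t \<bullet> d t)) \<le> t / \<kappa> * ((p + eps t *\<^sub>R v t) \<bullet> d t)"
    using t \<kappa> by (intro mult_left_mono) auto
  moreover have "t / \<kappa> * (eps t * (d t \<bullet> d t)) = damping * t powr (1 - 2 * r) * (d t \<bullet> d t)"
    by (simp only: mult.assoc[symmetric] eps_rate[OF t])
  ultimately show ?thesis
    unfolding u_slope_def power2_norm_eq_inner minus_mult_left[symmetric] by simp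
qed

text \<open>
The inner product of the subgradient with \<open>v - X\<close> bounds the excess of \<open>v\<close> over \<open>X\<close>, and by the
differential inclusion it equals \<open>- (\<kappa> / t)\<close> times the derivative of \<open>u\<close> up to small terms.
\<close>

lemma gap_v_le_path:
  assumes "solves_at t p"
  shows "gap (v t) + \<kappa> / t * u_slope t p
    \<le> gap (X t) + (2 * r * \<kappa> / t\<^sup>2 + eps t) * norm xmin * norm (d t)"
proof -
  have t: "0 < t" and p: "subgrad p (v t)" using assms t0 by (auto simp: solves_at_def)
  have "gap (v t) + p \<bullet> (X t - v t) \<le> gap (X t)"
    unfolding X_def by (intro subgradD p tikhonov_in_dom eps_pos t)
  then have 1: "gap (v t) - p \<bullet> d t \<le> gap (X t)"
    by (simp add: d_def inner_diff_right)
  have 2: "\<kappa> / t * u_slope t p = - (p \<bullet> d t) - eps t * (v t \<bullet> d t) + 2 * r * \<kappa> / t\<^sup>2 * norm xmin * norm (d t)"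
    using t \<kappa> by (simp add: u_slope_def inner_add_left power2_eq_square field_simps)
  have "- (v t \<bullet> d t) = - (norm (d t))\<^sup>2 - X t \<bullet> d t"
    by (simp add: d_def power2_norm_eq_inner inner_diff_left)
  also have "\<dots> \<le> norm (X t) * norm (d t)"
    using Cauchy_Schwarz_ineq2[of "X t" "d t"] zero_le_power2[of "norm (d t)"] by linarith
  also have "\<dots> \<le> norm xmin * norm (d t)"
    unfolding X_def by (intro mult_right_mono tikhonov_norm_le eps_pos t) auto
  finally have "eps t * (- (v t \<bullet> d t)) \<le> eps t * (norm xmin * norm (d t))"
    using eps_pos[OF t] by (intro mult_left_mono) auto
  then show ?thesis using 1 2 by (simp add: distrib_right)
qed

text \<open>
Where \<open>norm (d t)\<close> exceeds \<open>C * t powr (2 r - 2)\<close>, contraction beats the drift of the path, so for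
large \<open>C\<close> this function is a barrier for late times. It is seen to be a supersolution once
\<open>(2 - 2 r) * t powr (2 r - 2)\<close> is below half the damping constant; before that time the bound comes
from compactness.
\<close>

lemma d_bound:
  obtains C where "C \<ge> 0" "\<And>t. t0 \<le> t \<Longrightarrow> norm (d t) \<le> C * t powr (2 * r - 2)"
proof -
  have "((\<lambda>t::real. (2 - 2 * r) * t powr (2 * r - 2)) \<longlongrightarrow> (2 - 2 * r) * 0) at_top"
    using r by (intro tendsto_mult tendsto_const tendsto_neg_powr filterlim_ident) auto
  then have "\<forall>\<^sub>F t in at_top. (2 - 2 * r) * t powr (2 * r - 2) < damping / 2"
    using damping_pos by (intro order_tendstoD(2)) auto
  then obtain T0 where T0: "\<And>t. t \<ge> T0 \<Longrightarrow> (2 - 2 * r) * t powr (2 * r - 2) < damping / 2"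
    by (auto simp: eventually_at_top_linorder)
  (* From time T on, the decay rate of the barrier is at most half of the damping it meets. *)
  define T where "T = max t0 T0"
  have "continuous_on {t0..T} (\<lambda>t. norm (d t) * t powr (2 - 2 * r))"
    using t0 by (intro continuous_intros d_continuous_on) auto
  then obtain C1 where C1: "C1 \<ge> 0" "\<forall>t\<in>{t0..T}. norm (norm (d t) * t powr (2 - 2 * r)) \<le> C1"
    by (rule continuous_on_interval_bounded)
  (* The first entry covers the times up to T; the second lets the contraction at height
     C * t powr (2 * r - 2) be at least twice the drift of the path. *)
  define C where "C = max C1 (4 * r * norm xmin / damping)"
  have C: "C \<ge> 0" "C1 \<le> C" "4 * r * norm xmin / damping \<le> C" using C1(1) by (auto simp: C_def)
  have CC: "2 * r * norm xmin \<le> damping * C / 2"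
    using C(3) damping_pos by (simp add: pos_divide_le_eq mult_ac)
  have early: "norm (d t) \<le> C * t powr (2 * r - 2)" if t: "t0 \<le> t" "t \<le> T" for t
  proof -
    have "t powr (2 - 2 * r) * t powr (2 * r - 2) = 1"
      using t t0 by (simp add: powr_add[symmetric])
    then have "norm (d t) = norm (d t) * t powr (2 - 2 * r) * t powr (2 * r - 2)" by simp
    also have "\<dots> \<le> C * t powr (2 * r - 2)"
      using bspec[OF C1(2), of t] t C(2) by (intro mult_right_mono) auto
    finally show ?thesis .
  qed
  have late: "norm (d t) \<le> C * t powr (2 * r - 2)" if t: "T < t" for t
  proof -
    define g where "g s = u s + - C\<^sup>2 / 2 * s powr (4 * r - 4)" for s
    have sq: "(C * s powr (2 * r - 2))\<^sup>2 = C\<^sup>2 * s powr (4 * r - 4)" for s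
    proof -
      have "s powr (2 * r - 2) * s powr (2 * r - 2) = s powr (4 * r - 4)"
        by (simp add: powr_add[symmetric])
      then show ?thesis by (simp add: power_mult_distrib power2_eq_square)
    qed
    have T: "t0 \<le> T" "0 < T" using t0 by (auto simp: T_def)
    have "g t \<le> 0"
    proof (rule ac_upper_slope_barrier[where g=g and a=T and b=t])
      show "absolutely_continuous_fun_on {c..e} g" if "T \<le> c" for c e
        unfolding g_def using that T
        by (intro ac_add u_ac ac_cmult ac_powr) auto
      show "continuous_on {T..t} g"
        unfolding g_def using T
        by (intro continuous_intros continuous_on_subset[OF u_continuous_on]) auto
      have "(norm (d T))\<^sup>2 \<le> (C * T powr (2 * r - 2))\<^sup>2"
        using early[of T] T by (intro power_mono) auto
      then show "g T \<le> 0" by (simp add: g_def u_def sq)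
      show "AE s in lborel. T < s \<longrightarrow> s < t \<longrightarrow> g s > 0 \<longrightarrow> upper_slope_le g s 0"
        using ae_solves_at
      proof eventually_elim
        case (elim s)
        show ?case
        proof (intro impI)
          assume s: "T < s" "s < t" "g s > 0"
          then obtain p where p: "solves_at s p" using elim T by auto
          have s0: "0 < s" using s T by simp
          let ?N = "norm (d s)" and ?\<psi> = "s powr (2 * r - 2)"
          have "(C * ?\<psi>)\<^sup>2 < ?N\<^sup>2" using s(3) by (simp add: g_def u_def sq)
          then have N: "C * ?\<psi> \<le> ?N" by (simp add: power2_less_imp_less less_imp_le)
          have pw: "s powr (1 - 2 * r) * ?\<psi> = 1 / s"
            using s0 by (simp add: powr_add[symmetric] powr_minus_divide)
          have "4 * r - 4 - 1 = (2 * r - 2) + (2 * r - 2) - 1" by simp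
          then have pw2: "s powr (4 * r - 4 - 1) = ?\<psi> * ?\<psi> / s"
            using s0 by (simp only: powr_diff powr_add powr_one)
          have "damping * C / s = damping * s powr (1 - 2 * r) * (C * ?\<psi>)" using pw by (simp add: mult_ac)
          also have "\<dots> \<le> damping * s powr (1 - 2 * r) * ?N"
            using N damping_pos by (intro mult_left_mono) auto
          finally have a1: "damping * C / s \<le> damping * s powr (1 - 2 * r) * ?N" .
          have a2: "2 * r * norm xmin / s \<le> damping * C / 2 / s"
            using CC s0 by (intro divide_right_mono) auto
          have "u_slope s p \<le> ?N * (2 * r * norm xmin / s - damping * s powr (1 - 2 * r) * ?N)"
            using u_slope_le_contraction[OF p] by (simp add: power2_eq_square algebra_simps)
          also have "\<dots> \<le> ?N * (- (damping * C / 2 / s))"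
          proof (intro mult_left_mono)
            have "damping * C / s = damping * C / 2 / s + damping * C / 2 / s" by simp
            then show "2 * r * norm xmin / s - damping * s powr (1 - 2 * r) * ?N \<le> - (damping * C / 2 / s)"
              using a1 a2 by linarith
          qed simp
          also have "\<dots> \<le> (C * ?\<psi>) * (- (damping * C / 2 / s))"
            using N damping_pos C(1) s0 by (intro mult_right_mono_neg) auto
          finally have b1: "u_slope s p \<le> - (C\<^sup>2 * ?\<psi> / s * (damping / 2))"
            by (simp add: power2_eq_square mult_ac)
          have *: "C\<^sup>2 * ?\<psi> / s * ((2 - 2 * r) * ?\<psi>) \<le> C\<^sup>2 * ?\<psi> / s * (damping / 2)"
            using T0[of s] s s0 by (intro mult_left_mono) (auto simp: T_def)
          have b2: "- C\<^sup>2 / 2 * ((4 * r - 4) * s powr (4 * r - 4 - 1)) \<le> C\<^sup>2 * ?\<psi> / s * (damping / 2)"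
          proof -
            have "- C\<^sup>2 / 2 * ((4 * r - 4) * (\<psi> * \<psi> / s)) = C\<^sup>2 * \<psi> / s * ((2 - 2 * r) * \<psi>)" for \<psi>
              using s0 by (simp add: field_simps)
            then show ?thesis using * unfolding pw2 by simp
          qed
          have "upper_slope_le g s (u_slope s p + - C\<^sup>2 / 2 * ((4 * r - 4) * s powr (4 * r - 4 - 1)))"
            unfolding g_def using s0
            by (intro upper_slope_le_add u_upper_slope[OF p] upper_slope_le_deriv DERIV_cmult
                has_real_derivative_powr)
          then show "upper_slope_le g s 0"
            by (rule upper_slope_le_mono) (use add_mono[OF b1 b2] in simp)
        qed
      qed
    qed (use t in auto)
    then have "(norm (d t))\<^sup>2 \<le> (C * t powr (2 * r - 2))\<^sup>2" by (simp add: g_def u_def sq)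
    then show ?thesis by (rule power2_le_imp_le) (use C(1) in simp)
  qed
  have "norm (d t) \<le> C * t powr (2 * r - 2)" if "t0 \<le> t" for t
    using early[OF that] late[of t] by (cases "t \<le> T") auto
  then show thesis by (rule that[OF C(1)])
qed

section \<open>Strong convergence\<close>

lemma X_tendsto: "(X \<longlongrightarrow> xmin) at_top"
proof -
  have "((\<lambda>t::real. \<kappa> * damping * t powr (- 2 * r)) \<longlongrightarrow> \<kappa> * damping * 0) at_top"
    using r by (intro tendsto_mult tendsto_const tendsto_neg_powr filterlim_ident) auto
  then have "(eps \<longlongrightarrow> 0) at_top" by (simp add: eps_def[abs_def])
  moreover have "\<forall>\<^sub>F t in at_top. 0 < eps t"
    using eventually_gt_at_top[of 0] by eventually_elim (rule eps_pos)
  ultimately have "filterlim eps (at_right 0) at_top"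
    by (rule tendsto_imp_filterlim_at_right)
  then show ?thesis unfolding X_def[abs_def] by (rule filterlim_compose[OF tikhonov_tendsto])
qed

lemma v_tendsto: "(v \<longlongrightarrow> xmin) at_top"
proof -
  obtain C where C: "C \<ge> 0" "\<And>t. t0 \<le> t \<Longrightarrow> norm (d t) \<le> C * t powr (2 * r - 2)"
    using d_bound by auto
  have "((\<lambda>t::real. C * t powr (2 * r - 2)) \<longlongrightarrow> C * 0) at_top"
    using r by (intro tendsto_mult tendsto_const tendsto_neg_powr filterlim_ident) auto
  moreover have "\<forall>\<^sub>F t in at_top. norm (d t) \<le> C * t powr (2 * r - 2)"
    using eventually_ge_at_top[of t0] by eventually_elim (rule C(2))
  ultimately have "(d \<longlongrightarrow> 0) at_top"
    using Lim_null_comparison[of d "\<lambda>t. C * t powr (2 * r - 2)" at_top] by simp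
  then have "((\<lambda>t. d t + X t) \<longlongrightarrow> 0 + xmin) at_top" by (intro tendsto_add X_tendsto)
  then show ?thesis by (simp add: d_def)
qed

text \<open>
Once \<open>v\<close> stays within \<open>\<eta> / 2\<close> of the limit, half the squared distance of \<open>x\<close> relaxes towards at
most \<open>(\<eta> / 2)\<^sup>2 / 2\<close> at rate \<open>\<kappa> / t\<close>, which the factor \<open>t powr \<kappa>\<close> turns into monotonicity.
\<close>

lemma x_tendsto: "(x \<longlongrightarrow> xmin) at_top"
proof (rule tendstoI)
  fix \<eta> :: real assume \<eta>: "\<eta> > 0"
  define q where "q t = (norm (x t - xmin))\<^sup>2 / 2" for t
  have q_eq: "q t = (1/2) * ((x t - xmin) \<bullet> (x t - xmin))" for t
    by (simp add: q_def power2_norm_eq_inner)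
  have "\<forall>\<^sub>F t in at_top. dist (v t) xmin < \<eta>/2"
    using tendstoD[OF v_tendsto, of "\<eta>/2"] \<eta> by simp
  then obtain T0 where T0: "\<And>t. T0 \<le> t \<Longrightarrow> dist (v t) xmin < \<eta>/2"
    by (auto simp: eventually_at_top_linorder)
  define T where "T = max t0 T0"
  have T: "t0 \<le> T" "T0 \<le> T" "0 < T" using t0 by (auto simp: T_def)
  define g where "g t = t powr \<kappa> * (q t - (\<eta>/2)\<^sup>2 / 2)" for t
  have g_le: "g t \<le> g T" if t: "T \<le> t" for t
  proof (rule ac_upper_slope_nonpos_imp_le[OF _ t])
    have cx: "continuous_on {T..t} (\<lambda>t. x t - xmin)"
      using T by (intro continuous_intros continuous_on_subset[OF x_continuous_on]) auto
    have "absolutely_continuous_fun_on {T..t} (\<lambda>t. x t - xmin)"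
      using T by (intro ac_diff x_ac ac_const)
    then have 1: "absolutely_continuous_fun_on {T..t} (\<lambda>t. (x t - xmin) \<bullet> (x t - xmin))"
      by (intro ac_inner cx)
    have "absolutely_continuous_fun_on {T..t} q"
      unfolding q_eq[abs_def] by (intro ac_cmult 1)
    then have "absolutely_continuous_fun_on {T..t} (\<lambda>t. q t - (\<eta>/2)\<^sup>2 / 2)"
      by (intro ac_diff ac_const)
    moreover have "continuous_on {T..t} q"
      unfolding q_eq[abs_def] by (intro continuous_intros cx)
    ultimately show "absolutely_continuous_fun_on {T..t} g"
      unfolding g_def using T by (intro ac_mult ac_powr continuous_intros) auto
    show "AE s in lborel. T < s \<longrightarrow> s < t \<longrightarrow> upper_slope_le g s 0"
      using ae_solves_at
    proof eventually_elim
      case (elim s)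
      show ?case
      proof (intro impI)
        assume s: "T < s" "s < t"
        then obtain p where p: "solves_at s p" using elim T by auto
        have s0: "0 < s" using s T by simp
        define P where "P = s powr (\<kappa> - 1)"
        have P: "0 < P" "s powr \<kappa> = s * P"
          using s0 by (simp_all add: P_def powr_diff)
        define x' where "x' = - ((\<kappa> / s) *\<^sub>R (x s - v s))"
        have "(x has_vector_derivative x') (at s)" using p by (simp add: solves_at_def x'_def)
        then have "((\<lambda>s. (x s - xmin) \<bullet> (x s - xmin)) has_real_derivative
            (x s - xmin) \<bullet> x' + x' \<bullet> (x s - xmin)) (at s)"
          unfolding has_real_derivative_iff_has_vector_derivative has_vector_derivative_def
          by (auto intro!: derivative_eq_intros simp: inner_commute algebra_simps)
        then have "(q has_real_derivative (1/2) * ((x s - xmin) \<bullet> x' + x' \<bullet> (x s - xmin))) (at s)"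
          unfolding q_eq[abs_def] by (rule DERIV_cmult)
        then have q': "(q has_real_derivative (x' \<bullet> (x s - xmin))) (at s)"
          by (simp add: inner_commute)
        have "(g has_real_derivative
            s powr \<kappa> * (x' \<bullet> (x s - xmin)) + \<kappa> * s powr (\<kappa> - 1) * (q s - (\<eta>/2)\<^sup>2 / 2)) (at s)"
          unfolding g_def[abs_def] using s0
          by (auto intro!: derivative_eq_intros q' simp: P_def powr_diff)
        moreover have "s powr \<kappa> * (x' \<bullet> (x s - xmin)) + \<kappa> * s powr (\<kappa> - 1) * (q s - (\<eta>/2)\<^sup>2 / 2)
            = \<kappa> * P * (q s - (\<eta>/2)\<^sup>2 / 2 - (x s - v s) \<bullet> (x s - xmin))"
          using s0 P by (simp add: x'_def P_def[symmetric] algebra_simps)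
        moreover have "\<dots> \<le> 0"
        proof -
          have "(x s - v s) \<bullet> (x s - xmin) = 2 * q s - (v s - xmin) \<bullet> (x s - xmin)"
          proof -
            have "x s - v s = (x s - xmin) - (v s - xmin)" by simp
            then have "(x s - v s) \<bullet> (x s - xmin)
                = (x s - xmin) \<bullet> (x s - xmin) - (v s - xmin) \<bullet> (x s - xmin)"
              by (simp only: inner_diff_left[of "x s - xmin"])
            then show ?thesis using q_eq[of s] by simp
          qed
          moreover have "(v s - xmin) \<bullet> (x s - xmin) \<le> (\<eta>/2)\<^sup>2 / 2 + q s"
          proof -
            have "(v s - xmin) \<bullet> (x s - xmin) \<le> norm (v s - xmin) * norm (x s - xmin)"
              by (rule norm_cauchy_schwarz)
            also have "\<dots> \<le> (norm (v s - xmin))\<^sup>2 / 2 + q s"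
              using sum_squares_bound[of "norm (v s - xmin)" "norm (x s - xmin)"] by (simp add: q_def)
            also have "(norm (v s - xmin))\<^sup>2 \<le> (\<eta>/2)\<^sup>2"
              using T0[of s] s T \<eta> by (intro power_mono) (auto simp: dist_norm)
            finally show ?thesis by simp
          qed
          ultimately have "q s - (\<eta>/2)\<^sup>2 / 2 - (x s - v s) \<bullet> (x s - xmin) \<le> 0" by linarith
          then show ?thesis using \<kappa> P(1) by (intro mult_nonneg_nonpos) auto
        qed
        ultimately show "upper_slope_le g s 0"
          by (intro upper_slope_le_mono[OF upper_slope_le_deriv]) auto
      qed
    qed
  qed
  have "((\<lambda>t::real. g T * t powr (- \<kappa>)) \<longlongrightarrow> g T * 0) at_top"
    using \<kappa> by (intro tendsto_mult tendsto_const tendsto_neg_powr filterlim_ident) auto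
  moreover have "g T * 0 < (\<eta>/2)\<^sup>2 / 2" using \<eta> by simp
  ultimately have "\<forall>\<^sub>F t in at_top. g T * t powr (- \<kappa>) < (\<eta>/2)\<^sup>2 / 2"
    by (rule order_tendstoD(2))
  with eventually_ge_at_top[of T] show "\<forall>\<^sub>F t in at_top. dist (x t) xmin < \<eta>"
  proof eventually_elim
    case (elim t)
    have t: "0 < t" using elim T by simp
    have "q t - (\<eta>/2)\<^sup>2 / 2 = g t * t powr (- \<kappa>)"
      using t by (simp add: g_def powr_minus)
    also have "\<dots> \<le> g T * t powr (- \<kappa>)" using g_le[OF elim(1)] by (intro mult_right_mono) auto
    finally have "q t < (\<eta>/2)\<^sup>2" using elim(2) by simp
    then have "(norm (x t - xmin))\<^sup>2 < \<eta>\<^sup>2" using \<eta>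
      by (simp add: q_def power2_eq_square) (smt (verit) mult_pos_pos)
    then show ?case using \<eta> by (simp add: dist_norm power2_less_imp_less)
  qed
qed

section \<open>Decay of the values\<close>

text \<open>
The last summand on the left is kept because the product rule for the weight
\<open>\<kappa>\<^sup>2 * t powr (\<kappa> - 2)\<close> in front of \<open>u\<close> produces it in lemma \<open>gap_x_le\<close>. Everything besides
the excess along the path is of order \<open>1 / t\<^sup>2\<close> by lemma \<open>d_bound\<close>.
\<close>

lemma gap_v_le_path_plus_rate:
  obtains C where "C \<ge> 0"
    "\<And>t p. solves_at t p \<Longrightarrow> gap (v t) + \<kappa> / t * u_slope t p + \<kappa> * \<bar>\<kappa> - 2\<bar> * u t / t\<^sup>2 \<le> gap (X t) + C / t\<^sup>2"
proof -
  obtain C where C: "C \<ge> 0" "\<And>t. t0 \<le> t \<Longrightarrow> norm (d t) \<le> C * t powr (2 * r - 2)"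
    using d_bound by auto
  define A where "A = t0 powr (2 * r - 2)"
  define C' where "C' = (2 * r * \<kappa> * (C * A) + \<kappa> * damping * C) * norm xmin + \<kappa> * \<bar>\<kappa> - 2\<bar> * ((C * A)\<^sup>2 / 2)"
  have "gap (v t) + \<kappa> / t * u_slope t p + \<kappa> * \<bar>\<kappa> - 2\<bar> * u t / t\<^sup>2 \<le> gap (X t) + C' / t\<^sup>2"
    if p: "solves_at t p" for t p
  proof -
    have t: "t0 < t" "0 < t" using p t0 by (auto simp: solves_at_def)
    have "t powr (2 * r - 2) \<le> A"
      unfolding A_def using t t0 r by (intro powr_mono2') auto
    then have "C * t powr (2 * r - 2) \<le> C * A" using C(1) by (rule mult_left_mono)
    then have dA: "norm (d t) \<le> C * A" using C(2)[of t] t by linarith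
    have "eps t * norm (d t) \<le> eps t * (C * t powr (2 * r - 2))"
      using C(2)[of t] t eps_pos[of t] by (intro mult_left_mono) auto
    also have "\<dots> = \<kappa> * damping * C / t\<^sup>2"
    proof -
      have "t powr (- 2 * r) * t powr (2 * r - 2) = 1 / t\<^sup>2"
        using powr_mult_eq_inverse_square[OF t(2), of "2 * r"] by (simp add: mult.commute)
      then show ?thesis by (simp add: eps_def mult_ac)
    qed
    finally have e: "eps t * norm (d t) \<le> \<kappa> * damping * C / t\<^sup>2" .
    have n: "2 * r * \<kappa> / t\<^sup>2 * norm (d t) \<le> 2 * r * \<kappa> / t\<^sup>2 * (C * A)"
      using dA r \<kappa> by (intro mult_left_mono) auto
    have "(2 * r * \<kappa> / t\<^sup>2 + eps t) * norm xmin * norm (d t)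
        = (2 * r * \<kappa> / t\<^sup>2 * norm (d t) + eps t * norm (d t)) * norm xmin"
      by (simp add: algebra_simps)
    also have "\<dots> \<le> (2 * r * \<kappa> / t\<^sup>2 * (C * A) + \<kappa> * damping * C / t\<^sup>2) * norm xmin"
      using e n by (intro mult_right_mono add_mono) auto
    also have "\<dots> = (2 * r * \<kappa> * (C * A) + \<kappa> * damping * C) * norm xmin / t\<^sup>2"
      by (simp add: add_divide_distrib distrib_right)
    finally have 1: "(2 * r * \<kappa> / t\<^sup>2 + eps t) * norm xmin * norm (d t)
        \<le> (2 * r * \<kappa> * (C * A) + \<kappa> * damping * C) * norm xmin / t\<^sup>2" .
    have "u t \<le> (C * A)\<^sup>2 / 2"
      unfolding u_def using dA by (intro divide_right_mono power_mono) auto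
    then have 2: "\<kappa> * \<bar>\<kappa> - 2\<bar> * u t / t\<^sup>2 \<le> \<kappa> * \<bar>\<kappa> - 2\<bar> * ((C * A)\<^sup>2 / 2) / t\<^sup>2"
      using \<kappa> by (intro divide_right_mono mult_left_mono) auto
    show ?thesis using gap_v_le_path[OF p] 1 2 by (simp only: C'_def add_divide_distrib)
  qed
  moreover have "C' \<ge> 0"
    using C(1) r \<kappa> damping_pos by (auto simp: C'_def A_def intro!: add_nonneg_nonneg mult_nonneg_nonneg)
  ultimately show thesis using that by blast
qed

text \<open>
Affine minorants recover a lower semicontinuous convex function. For the proximal
points \<open>J\<^sub>n\<close> of \<open>z\<close> with parameter \<open>n + 1\<close> the minorant at \<open>z\<close> equals
\<open>gap J\<^sub>n + (n + 1) * norm (z - J\<^sub>n)\<^sup>2\<close>, so a common bound forces \<open>J\<^sub>n\<close> to tend to \<open>z\<close>.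
\<close>

lemma gap_le_of_affine_minorants:
  assumes B: "\<And>y p. subgrad p y \<Longrightarrow> gap y + p \<bullet> (z - y) \<le> B"
  shows "z \<in> dom" and "gap z \<le> B"
proof -
  have "\<exists>J. subgrad (real (Suc n) *\<^sub>R (z - J)) J" for n
    by (rule prox_exists) simp
  then obtain J where J: "\<And>n. subgrad (real (Suc n) *\<^sub>R (z - J n)) (J n)" by metis
  have Jd: "J n \<in> dom" for n using J by (rule subgrad_in_dom)
  have est: "gap (J n) + real (Suc n) * (norm (z - J n))\<^sup>2 \<le> B" for n
    using B[OF J[of n]] by (simp add: power2_norm_eq_inner)
  have gB: "gap (J n) \<le> B" for n
  proof -
    have "0 \<le> real (Suc n) * (norm (z - J n))\<^sup>2" by simp
    then show ?thesis using est[of n] by linarith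
  qed
  have nB: "(norm (J n - z))\<^sup>2 \<le> inverse (real (Suc n)) * B" for n
  proof -
    have "real (Suc n) * (norm (z - J n))\<^sup>2 \<le> B" using est[of n] gap_nonneg[OF Jd[of n]] by linarith
    then have "inverse (real (Suc n)) * (real (Suc n) * (norm (z - J n))\<^sup>2) \<le> inverse (real (Suc n)) * B"
      by (intro mult_left_mono) auto
    then show ?thesis by (simp add: norm_minus_commute mult.assoc[symmetric] del: of_nat_Suc)
  qed
  have "(\<lambda>n. inverse (real (Suc n)) * B) \<longlonglongrightarrow> 0 * B"
    by (intro tendsto_intros LIMSEQ_inverse_real_of_nat)
  then have "(\<lambda>n. (norm (J n - z))\<^sup>2) \<longlonglongrightarrow> 0"
    using nB by (intro Lim_null_comparison[of "\<lambda>n. (norm (J n - z))\<^sup>2"]) auto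
  then have "(\<lambda>n. sqrt ((norm (J n - z))\<^sup>2)) \<longlonglongrightarrow> sqrt 0" by (rule tendsto_real_sqrt)
  then have "(\<lambda>n. J n - z) \<longlonglongrightarrow> 0" by (simp add: tendsto_norm_zero_iff)
  then have "J \<longlonglongrightarrow> z" by (rule LIM_zero_cancel)
  from gap_lsc[OF this Jd gB tendsto_const] show "z \<in> dom" "gap z \<le> B" by auto
qed

text \<open>
Here \<open>x\<close> is seen as the average of \<open>v\<close>. For an affine minorant \<open>l\<close> of the excess, the derivative
of \<open>t powr \<kappa> * l (x t)\<close> is \<open>\<kappa> * t powr (\<kappa> - 1) * l (v t)\<close>, and \<open>l (v t)\<close> is at most the excess of
\<open>v t\<close>. Adding \<open>\<kappa>\<^sup>2 * t powr (\<kappa> - 2) * u t\<close> absorbs the derivative of \<open>u\<close> in the bound for that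
excess. The function \<open>Y\<close> stands for an antiderivative of a majorant of what remains; the
constant \<open>K\<close> does not depend on the minorant, so the bound passes to the excess of \<open>x t\<close>.
The finite excess of \<open>x0\<close> enters \<open>K\<close> as a bound on the initial values of all the minorants.
\<close>

lemma gap_x_le:
  assumes C: "\<And>t p. solves_at t p \<Longrightarrow>
      gap (v t) + \<kappa> / t * u_slope t p + \<kappa> * \<bar>\<kappa> - 2\<bar> * u t / t\<^sup>2 \<le> gap (X t) + C / t\<^sup>2"
    and Y: "\<And>b. absolutely_continuous_fun_on {t0..b} Y"
      "\<And>s. t0 < s \<Longrightarrow> upper_slope_le (\<lambda>s. - Y s) s (- (\<kappa> * s powr (\<kappa> - 1) * (gap (X s) + C / s\<^sup>2)))"
  obtains K where "\<And>t. t0 \<le> t \<Longrightarrow> x t \<in> dom"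
    "\<And>t. t0 \<le> t \<Longrightarrow> gap (x t) \<le> (K + Y t) / t powr \<kappa>"
proof -
  define K where "K = t0 powr \<kappa> * gap x0 + \<kappa>\<^sup>2 * t0 powr (\<kappa> - 2) * u t0 - Y t0"
  have main: "gap y + p \<bullet> (x t - y) \<le> (K + Y t) / t powr \<kappa>" if t: "t0 \<le> t" and py: "subgrad p y" for t y p
  proof -
    define l where "l w = gap y + p \<bullet> (w - y)" for w
    have l_le: "l w \<le> gap w" if "w \<in> dom" for w
      using subgradD[OF py that] by (simp add: l_def)
    define g where "g s = (s powr \<kappa> * l (x s) + \<kappa>\<^sup>2 * s powr (\<kappa> - 2) * u s) + - Y s" for s
    have "g t \<le> g t0"
    proof (rule ac_upper_slope_nonpos_imp_le[OF _ t])
      have lc: "continuous_on {t0..t} (\<lambda>s. l (x s))"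
        unfolding l_def by (intro continuous_intros x_continuous_on)
      have "absolutely_continuous_fun_on {t0..t} (\<lambda>s. p \<bullet> (x s - y))"
        by (intro ac_inner ac_const ac_diff x_ac continuous_intros x_continuous_on) simp
      then have 1: "absolutely_continuous_fun_on {t0..t} (\<lambda>s. l (x s))"
        unfolding l_def by (intro ac_add ac_const)
      have 2: "absolutely_continuous_fun_on {t0..t} (\<lambda>s. s powr \<kappa> * l (x s))"
        using t0 by (intro ac_mult 1 lc ac_powr continuous_intros) auto
      have 3: "absolutely_continuous_fun_on {t0..t} (\<lambda>s. \<kappa>\<^sup>2 * s powr (\<kappa> - 2))"
        using t0 by (intro ac_cmult ac_powr)
      have 4: "absolutely_continuous_fun_on {t0..t} (\<lambda>s. \<kappa>\<^sup>2 * s powr (\<kappa> - 2) * u s)"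
        using t0 by (intro ac_mult 3 u_ac u_continuous_on continuous_intros) auto
      have "absolutely_continuous_fun_on {t0..t} (\<lambda>s. 0 - Y s)" by (intro ac_diff ac_const Y(1))
      then show "absolutely_continuous_fun_on {t0..t} g"
        unfolding g_def by (intro ac_add 2 4) simp
      show "AE s in lborel. t0 < s \<longrightarrow> s < t \<longrightarrow> upper_slope_le g s 0"
        using ae_solves_at
      proof eventually_elim
        case (elim s)
        show ?case
        proof (intro impI)
          assume s: "t0 < s" "s < t"
          then obtain p' where p': "solves_at s p'" using elim by auto
          have s0: "0 < s" using s t0 by simp
          define P where "P = s powr (\<kappa> - 1)"
          have P: "0 < P" "s powr \<kappa> = s * P" "s powr (\<kappa> - 2) = P / s" "s powr (\<kappa> - 2 - 1) = P / s\<^sup>2"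
            using s0 by (simp_all add: P_def powr_diff power2_eq_square power3_eq_cube)
          define x' where "x' = - ((\<kappa> / s) *\<^sub>R (x s - v s))"
          have xd: "(x has_vector_derivative x') (at s)" using p' by (simp add: solves_at_def x'_def)
          have "((\<lambda>s. l (x s)) has_real_derivative p \<bullet> x') (at s)"
            unfolding l_def has_real_derivative_iff_has_vector_derivative
            using xd unfolding has_vector_derivative_def
            by (auto intro!: derivative_eq_intros simp: mult.commute)
          then have "((\<lambda>s. s powr \<kappa> * l (x s)) has_real_derivative
              \<kappa> * s powr (\<kappa> - 1) * l (x s) + p \<bullet> x' * s powr \<kappa>) (at s)"
            using s0 by (intro DERIV_mult has_real_derivative_powr)
          moreover have "\<kappa> * s powr (\<kappa> - 1) * l (x s) + p \<bullet> x' * s powr \<kappa> = \<kappa> * P * l (v s)"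
            using s0 P(1,2)
            by (simp add: P_def[symmetric] x'_def l_def inner_diff_right algebra_simps)
          ultimately have 5: "upper_slope_le (\<lambda>s. s powr \<kappa> * l (x s)) s (\<kappa> * P * l (v s))"
            by (intro upper_slope_le_deriv) simp
          have "((\<lambda>s. \<kappa>\<^sup>2 * s powr (\<kappa> - 2)) has_real_derivative \<kappa>\<^sup>2 * ((\<kappa> - 2) * s powr (\<kappa> - 2 - 1))) (at s)"
            using s0 by (intro DERIV_cmult has_real_derivative_powr)
          then have 6: "upper_slope_le (\<lambda>s. \<kappa>\<^sup>2 * s powr (\<kappa> - 2) * u s) s
              (\<kappa>\<^sup>2 * s powr (\<kappa> - 2) * u_slope s p' + \<kappa>\<^sup>2 * ((\<kappa> - 2) * s powr (\<kappa> - 2 - 1)) * u s)"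
            using \<kappa> s0 by (intro upper_slope_le_mult u_upper_slope[OF p']) auto
          have vd: "v s \<in> dom" using p' subgrad_in_dom by (auto simp: solves_at_def)
          have "l (v s) + \<kappa> / s * u_slope s p' + \<kappa> * (\<kappa> - 2) * u s / s\<^sup>2 \<le> gap (X s) + C / s\<^sup>2"
          proof -
            have "\<kappa> * (\<kappa> - 2) * u s / s\<^sup>2 \<le> \<kappa> * \<bar>\<kappa> - 2\<bar> * u s / s\<^sup>2"
              using \<kappa> by (intro divide_right_mono mult_right_mono mult_left_mono) (auto simp: u_def)
            then have "l (v s) + \<kappa> / s * u_slope s p' + \<kappa> * (\<kappa> - 2) * u s / s\<^sup>2
                \<le> gap (v s) + \<kappa> / s * u_slope s p' + \<kappa> * \<bar>\<kappa> - 2\<bar> * u s / s\<^sup>2"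
              using l_le[OF vd] by (intro add_mono order_refl)
            then show ?thesis using C[OF p'] by (rule order_trans)
          qed
          then have "\<kappa> * P * (l (v s) + \<kappa> / s * u_slope s p' + \<kappa> * (\<kappa> - 2) * u s / s\<^sup>2)
              \<le> \<kappa> * P * (gap (X s) + C / s\<^sup>2)"
            using \<kappa> P(1) by (intro mult_left_mono) auto
          moreover have "\<kappa> * P * (l (v s) + \<kappa> / s * u_slope s p' + \<kappa> * (\<kappa> - 2) * u s / s\<^sup>2)
              = \<kappa> * P * l (v s) + (\<kappa>\<^sup>2 * (P / s) * u_slope s p' + \<kappa>\<^sup>2 * ((\<kappa> - 2) * (P / s\<^sup>2)) * u s)"
            by (simp add: algebra_simps power2_eq_square)
          ultimately have le: "\<kappa> * P * l (v s) + (\<kappa>\<^sup>2 * s powr (\<kappa> - 2) * u_slope s p'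
                + \<kappa>\<^sup>2 * ((\<kappa> - 2) * s powr (\<kappa> - 2 - 1)) * u s)
              + - (\<kappa> * s powr (\<kappa> - 1) * (gap (X s) + C / s\<^sup>2)) \<le> 0"
            unfolding P(3,4) P_def[symmetric] by linarith
          show "upper_slope_le g s 0"
            unfolding g_def
            by (rule upper_slope_le_mono[OF upper_slope_le_add[OF upper_slope_le_add[OF 5 6] Y(2)[OF s(1)]] le])
        qed
      qed
    qed
    moreover have "t0 powr \<kappa> * l (x t0) \<le> t0 powr \<kappa> * gap x0"
      using l_le[OF x0] init by (intro mult_left_mono) auto
    moreover have "0 \<le> \<kappa>\<^sup>2 * t powr (\<kappa> - 2) * u t" by (simp add: u_def)
    ultimately have "t powr \<kappa> * l (x t) \<le> K + Y t" unfolding g_def K_def by linarith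
    then show ?thesis using t t0 by (simp add: l_def pos_le_divide_eq mult.commute)
  qed
  have "x t \<in> dom \<and> gap (x t) \<le> (K + Y t) / t powr \<kappa>" if "t0 \<le> t" for t
    using gap_le_of_affine_minorants[OF main[OF that]] by blast
  then show thesis using that by blast
qed

text \<open>
The regularized value grows along the path at a rate of at least the excess times the
derivative of \<open>1 / eps\<close>. Lemma \<open>tikhonov_value_diff_ge\<close> gives this on the left of \<open>t\<close> directly;
on the right it involves the excess at \<open>s\<close>, which the subgradient at \<open>X t\<close> and the
Lipschitz estimate bound from below.
\<close>

lemma X_value_upper_slope:
  assumes "0 < t"
  shows "upper_slope_le (\<lambda>s. - tikhonov_value (eps s)) t
           (- (gap (X t) * (2 * r / (\<kappa> * damping) * t powr (2 * r - 1))))"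
proof -
  define w where "w s = 1 / (\<kappa> * damping) * s powr (2 * r)" for s
  have w_eq: "1 / eps s = w s" if "0 < s" for s
    using that by (simp add: w_def eps_def powr_minus_divide)
  have "(w has_real_derivative 1 / (\<kappa> * damping) * (2 * r * t powr (2 * r - 1))) (at t)"
    unfolding w_def[abs_def] by (intro DERIV_cmult has_real_derivative_powr assms)
  then have wd: "((\<lambda>s. (w s - w t) / (s - t)) \<longlongrightarrow> 2 * r / (\<kappa> * damping) * t powr (2 * r - 1)) (at t)"
    by (simp add: has_field_derivative_iff)
  have "((\<lambda>s. \<bar>eps s - eps t\<bar> / eps t * norm xmin) \<longlongrightarrow> \<bar>eps t - eps t\<bar> / eps t * norm xmin) (at t)"
    using DERIV_isCont[OF eps_deriv[OF assms]] eps_pos[OF assms]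
    by (intro tendsto_intros) (auto simp: isCont_def)
  then have lim0: "((\<lambda>s. \<bar>eps s - eps t\<bar> / eps t * norm xmin) \<longlongrightarrow> 0) (at t)" by simp
  define B where "B s = - ((gap (X t) - eps t * (norm xmin * (\<bar>eps s - eps t\<bar> / eps t * norm xmin)))
      * ((w s - w t) / (s - t)))" for s
  have "(B \<longlongrightarrow> - ((gap (X t) - eps t * (norm xmin * 0)) * (2 * r / (\<kappa> * damping) * t powr (2 * r - 1)))) (at t)"
    unfolding B_def by (intro tendsto_intros lim0 wd)
  then have "(B \<longlongrightarrow> - (gap (X t) * (2 * r / (\<kappa> * damping) * t powr (2 * r - 1)))) (at t)" by simp
  moreover have "\<forall>\<^sub>F s in at t. (- tikhonov_value (eps s) - - tikhonov_value (eps t)) / (s - t) \<le> B s"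
  proof -
    have "\<forall>\<^sub>F s in at t. 0 < s" using order_tendstoD(1)[OF tendsto_ident_at assms] .
    moreover have "\<forall>\<^sub>F s in at t. s \<noteq> t" by (auto simp: eventually_at_filter)
    ultimately show ?thesis
    proof eventually_elim
      case (elim s)
      let ?G = "gap (X t) - eps t * (norm xmin * (\<bar>eps s - eps t\<bar> / eps t * norm xmin))"
      have es: "0 < eps s" and et: "0 < eps t" using elim assms by (auto intro: eps_pos)
      have "\<bar>X t \<bullet> (X s - X t)\<bar> \<le> norm xmin * (\<bar>eps s - eps t\<bar> / eps t * norm xmin)"
        using Cauchy_Schwarz_ineq2[of "X t" "X s - X t"] tikhonov_norm_le[OF et]
          X_diff[OF elim(1) assms]
        by (smt (verit) X_def mult_mono norm_ge_zero)
      then have inn: "eps t * (X t \<bullet> (X s - X t)) \<le> eps t * (norm xmin * (\<bar>eps s - eps t\<bar> / eps t * norm xmin))"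
        using et by (intro mult_left_mono) auto
      have Gs: "?G \<le> gap (X s)"
        using subgradD[OF tikhonov_subgrad[OF et] tikhonov_in_dom[OF es]] inn by (simp add: X_def)
      have Gt: "?G \<le> gap (X t)" using et by simp
      have "?G * ((w s - w t) / (s - t)) \<le> (tikhonov_value (eps s) - tikhonov_value (eps t)) / (s - t)"
      proof (cases "t < s")
        case True
        then have "w t \<le> w s"
          unfolding w_def using assms r \<kappa> damping_pos by (intro mult_left_mono powr_mono2) auto
        then have "?G * (w s - w t) \<le> gap (X s) * (w s - w t)"
          using Gs by (intro mult_right_mono) auto
        also have "\<dots> \<le> tikhonov_value (eps s) - tikhonov_value (eps t)"
          using tikhonov_value_diff_ge[OF et es] w_eq[OF elim(1)] w_eq[OF assms] by (simp add: X_def)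
        finally show ?thesis using True by (simp add: divide_right_mono)
      next
        case False
        then have st: "s < t" using elim by simp
        then have "w s \<le> w t"
          unfolding w_def using elim(1) r \<kappa> damping_pos by (intro mult_left_mono powr_mono2) auto
        then have "?G * (w t - w s) \<le> gap (X t) * (w t - w s)"
          using Gt by (intro mult_right_mono) auto
        also have "\<dots> \<le> tikhonov_value (eps t) - tikhonov_value (eps s)"
          using tikhonov_value_diff_ge[OF es et] w_eq[OF elim(1)] w_eq[OF assms] by (simp add: X_def)
        finally have "?G * (w t - w s) / (t - s) \<le> (tikhonov_value (eps t) - tikhonov_value (eps s)) / (t - s)"
          using st by (intro divide_right_mono) auto
        moreover have "(a - b) / (s - t) = (b - a) / (t - s)" for a b :: real
          by (metis minus_diff_eq minus_divide_divide)
        ultimately show ?thesis by (metis times_divide_eq_right)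
      qed
      moreover have "(- tikhonov_value (eps s) - - tikhonov_value (eps t)) / (s - t)
          = - ((tikhonov_value (eps s) - tikhonov_value (eps t)) / (s - t))"
        by (simp add: minus_divide_left)
      ultimately show ?case unfolding B_def by linarith
    qed
  qed
  ultimately show ?thesis by (intro upper_slope_leI)
qed

lemma X_gap_le:
  assumes "0 < t"
  shows "gap (X t) \<le> \<kappa> * damping * (norm xmin)\<^sup>2 / 2 * t powr (- 2 * r)"
  using tikhonov_gap_le[OF eps_pos[OF assms]] by (simp add: X_def eps_def mult_ac)

lemma X_value_ac: "absolutely_continuous_fun_on {t0..b} (\<lambda>s. tikhonov_value (eps s))"
proof -
  obtain L where L: "L \<ge> 0"
    "\<And>s t. s \<in> {t0..b} \<Longrightarrow> t \<in> {t0..b} \<Longrightarrow> \<bar>t powr (2 * r) - s powr (2 * r)\<bar> \<le> L * \<bar>t - s\<bar>"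
    using powr_Lipschitz[OF t0, of b "2 * r"] by auto
  define G where "G = \<kappa> * damping * (norm xmin)\<^sup>2 / 2 * t0 powr (- 2 * r)"
  define M where "M = G * (1 / (\<kappa> * damping) * L)"
  have one: "tikhonov_value (eps s) - tikhonov_value (eps t) \<le> M * \<bar>t - s\<bar>"
    if st: "s \<in> {t0..b}" "t \<in> {t0..b}" for s t
  proof -
    have pos: "0 < s" "0 < t" using st t0 by auto
    have G0: "0 \<le> gap (X t)" using tikhonov_gap_nonneg[OF eps_pos[OF pos(2)]] by (simp add: X_def)
    have "t powr (- 2 * r) \<le> t0 powr (- 2 * r)" using st t0 r by (intro powr_mono2') auto
    then have "\<kappa> * damping * (norm xmin)\<^sup>2 / 2 * t powr (- 2 * r) \<le> G"
      unfolding G_def using \<kappa> damping_pos by (intro mult_left_mono) auto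
    then have GG: "gap (X t) \<le> G" using X_gap_le[OF pos(2)] by linarith
    have inv: "1 / eps q = 1 / (\<kappa> * damping) * q powr (2 * r)" if "0 < q" for q
      using that by (simp add: eps_def powr_minus_divide)
    have "tikhonov_value (eps s) - tikhonov_value (eps t) \<le> gap (X t) * (1 / eps s - 1 / eps t)"
      using tikhonov_value_diff_ge[OF eps_pos[OF pos(1)] eps_pos[OF pos(2)]]
      by (simp add: X_def algebra_simps)
    also have "1 / eps s - 1 / eps t \<le> 1 / (\<kappa> * damping) * (L * \<bar>t - s\<bar>)"
    proof -
      have "s powr (2 * r) - t powr (2 * r) \<le> L * \<bar>t - s\<bar>"
        using L(2)[OF st] by linarith
      then have "1 / (\<kappa> * damping) * (s powr (2 * r) - t powr (2 * r)) \<le> 1 / (\<kappa> * damping) * (L * \<bar>t - s\<bar>)"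
        using \<kappa> damping_pos by (intro mult_left_mono) auto
      then show ?thesis by (simp only: inv[OF pos(1)] inv[OF pos(2)] right_diff_distrib)
    qed
    also have "gap (X t) * (1 / (\<kappa> * damping) * (L * \<bar>t - s\<bar>)) \<le> G * (1 / (\<kappa> * damping) * (L * \<bar>t - s\<bar>))"
      using GG L(1) \<kappa> damping_pos by (intro mult_right_mono) auto
    finally show ?thesis using G0 by (simp add: M_def mult_left_mono)
  qed
  show ?thesis
  proof (rule ac_Lipschitz)
    show "norm (tikhonov_value (eps t) - tikhonov_value (eps s)) \<le> M * (t - s)"
      if "s \<in> {t0..b}" "t \<in> {t0..b}" "s \<le> t" for s t
      using one[OF that(1,2)] one[OF that(2,1)] that(3) by (simp add: abs_le_iff)
  qed
qed

text \<open>
The weight \<open>\<kappa> * s powr (\<kappa> - 1)\<close> times the \<open>1 / s\<^sup>2\<close> remainder is harmless in both cases.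
For \<open>2 r < \<kappa>\<close> the weighted path excess grows like \<open>s powr (\<kappa> - 2 r - 1)\<close>, whose integral gives the
rate \<open>t powr (- 2 r)\<close>. For \<open>\<kappa> \<le> 2 r\<close>, including the critical case \<open>\<kappa> = 2 r\<close>, the weighted path
excess is dominated by the growth of the bounded regularized value, so \<open>Y\<close> is bounded above
and the rate is \<open>t powr (- \<kappa>)\<close>.
\<close>

lemma gap_x_rate:
  obtains C where "\<And>t. t0 \<le> t \<Longrightarrow> x t \<in> dom"
    "\<And>t. t0 \<le> t \<Longrightarrow> gap (x t) \<le> C * (1 / t powr \<kappa> + 1 / t powr (2 * r))"
proof -
  obtain C where C0: "C \<ge> 0" and C: "\<And>t p. solves_at t p \<Longrightarrow>
      gap (v t) + \<kappa> / t * u_slope t p + \<kappa> * \<bar>\<kappa> - 2\<bar> * u t / t\<^sup>2 \<le> gap (X t) + C / t\<^sup>2"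
    using gap_v_le_path_plus_rate by auto
  show thesis
  proof (cases "2 * r < \<kappa>")
    case True
    define A where "A = \<kappa> * damping * (norm xmin)\<^sup>2 / 2 + C * t0 powr (2 * r - 2)"
    (* D * s powr (\<kappa> - 2 * r) is an antiderivative of \<kappa> * A * s powr (\<kappa> - 2 * r - 1). *)
    define D where "D = \<kappa> * A / (\<kappa> - 2 * r)"
    define Y where "Y s = D * s powr (\<kappa> - 2 * r)" for s
    obtain K where K: "\<And>t. t0 \<le> t \<Longrightarrow> x t \<in> dom"
      "\<And>t. t0 \<le> t \<Longrightarrow> gap (x t) \<le> (K + Y t) / t powr \<kappa>"
    proof (rule gap_x_le[OF C, of Y])
      show "absolutely_continuous_fun_on {t0..b} Y" for b
        unfolding Y_def using t0 by (intro ac_cmult ac_powr)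
      show "upper_slope_le (\<lambda>s. - Y s) s (- (\<kappa> * s powr (\<kappa> - 1) * (gap (X s) + C / s\<^sup>2)))"
        if s: "t0 < s" for s
      proof -
        have s0: "0 < s" using s t0 by simp
        have "((\<lambda>s. - D * s powr (\<kappa> - 2 * r)) has_real_derivative
            - D * ((\<kappa> - 2 * r) * s powr (\<kappa> - 2 * r - 1))) (at s)"
          using s0 by (intro DERIV_cmult has_real_derivative_powr)
        then have d1: "upper_slope_le (\<lambda>s. - Y s) s (- D * ((\<kappa> - 2 * r) * s powr (\<kappa> - 2 * r - 1)))"
          by (intro upper_slope_le_deriv) (simp add: Y_def)
        have "C / s\<^sup>2 \<le> C * t0 powr (2 * r - 2) * s powr (- 2 * r)"
        proof -
          have "s powr (2 * r - 2) \<le> t0 powr (2 * r - 2)" using s t0 r by (intro powr_mono2') auto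
          then have "s powr (2 * r - 2) * s powr (- 2 * r) \<le> t0 powr (2 * r - 2) * s powr (- 2 * r)"
            by (intro mult_right_mono) auto
          moreover have "s powr (2 * r - 2) * s powr (- 2 * r) = 1 / s\<^sup>2"
            using powr_mult_eq_inverse_square[OF s0, of "2 * r"] by simp
          ultimately have "C * (1 / s\<^sup>2) \<le> C * (t0 powr (2 * r - 2) * s powr (- 2 * r))"
            using C0 by (intro mult_left_mono) auto
          then show ?thesis by (simp add: mult.assoc)
        qed
        then have "gap (X s) + C / s\<^sup>2 \<le> A * s powr (- 2 * r)"
          using X_gap_le[OF s0] by (simp only: A_def distrib_right)
        then have "\<kappa> * s powr (\<kappa> - 1) * (gap (X s) + C / s\<^sup>2)
            \<le> \<kappa> * s powr (\<kappa> - 1) * (A * s powr (- 2 * r))"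
          using \<kappa> by (intro mult_left_mono) auto
        also have "\<dots> = D * ((\<kappa> - 2 * r) * s powr (\<kappa> - 2 * r - 1))"
        proof -
          have "s powr (\<kappa> - 1) * s powr (- 2 * r) = s powr (\<kappa> - 2 * r - 1)"
            by (simp add: powr_add[symmetric] algebra_simps)
          moreover have "D * (\<kappa> - 2 * r) = \<kappa> * A" using True by (simp add: D_def)
          ultimately show ?thesis by (metis (no_types, opaque_lifting) mult.assoc mult.commute)
        qed
        finally show ?thesis by (intro upper_slope_le_mono[OF d1]) simp
      qed
    qed auto
    show thesis
    proof (rule that[OF K(1)])
      fix t assume t: "t0 \<le> t"
      have t0': "0 < t" using t t0 by simp
      have "gap (x t) \<le> K / t powr \<kappa> + D / t powr (2 * r)"
        using K(2)[OF t] t0' by (simp add: Y_def add_divide_distrib powr_diff)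
      also have "\<dots> \<le> max K D * (1 / t powr \<kappa>) + max K D * (1 / t powr (2 * r))"
        using t0' by (intro add_mono) (auto simp: divide_simps)
      finally show "gap (x t) \<le> max K D * (1 / t powr \<kappa> + 1 / t powr (2 * r))"
        by (simp add: distrib_left)
    qed
  next
    case False
    then have \<kappa>2: "\<kappa> < 2" using r by simp
    (* The factor t0 powr (\<kappa> - 2 * r) bounds s powr (\<kappa> - 2 * r), which is nonincreasing in this case;
       D belongs to the antiderivative of \<kappa> * C * s powr (\<kappa> - 3), which is negative because \<kappa> < 2. *)
    define A where "A = \<kappa>\<^sup>2 * damping / (2 * r) * t0 powr (\<kappa> - 2 * r)"
    define D where "D = \<kappa> * C / (2 - \<kappa>)"
    have A0: "A > 0" using r \<kappa> damping_pos t0 by (simp add: A_def)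
    have D0: "D \<ge> 0" using C0 \<kappa> \<kappa>2 by (simp add: D_def)
    define Y where "Y s = A * tikhonov_value (eps s) - D * s powr (\<kappa> - 2)" for s
    obtain K where K: "\<And>t. t0 \<le> t \<Longrightarrow> x t \<in> dom"
      "\<And>t. t0 \<le> t \<Longrightarrow> gap (x t) \<le> (K + Y t) / t powr \<kappa>"
    proof (rule gap_x_le[OF C, of Y])
      show "absolutely_continuous_fun_on {t0..b} Y" for b
        unfolding Y_def using t0
        by (intro ac_diff ac_cmult ac_powr X_value_ac) auto
      show "upper_slope_le (\<lambda>s. - Y s) s (- (\<kappa> * s powr (\<kappa> - 1) * (gap (X s) + C / s\<^sup>2)))"
        if s: "t0 < s" for s
      proof -
        have s0: "0 < s" using s t0 by simp
        define P where "P = s powr (\<kappa> - 1)"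
        have P: "s powr (\<kappa> - 2 - 1) = P / s\<^sup>2"
          using s0 by (simp_all add: P_def powr_diff power2_eq_square power3_eq_cube)
        have e1: "upper_slope_le (\<lambda>s. A * - tikhonov_value (eps s)) s
            (A * - (gap (X s) * (2 * r / (\<kappa> * damping) * s powr (2 * r - 1))))"
          using upper_slope_le_mult[OF DERIV_const A0 X_value_upper_slope[OF s0]] by simp
        have e2: "upper_slope_le (\<lambda>s. D * s powr (\<kappa> - 2)) s (D * ((\<kappa> - 2) * s powr (\<kappa> - 2 - 1)))"
          using s0 by (intro upper_slope_le_deriv DERIV_cmult has_real_derivative_powr)
        have gX: "0 \<le> gap (X s)" using tikhonov_gap_nonneg[OF eps_pos[OF s0]] by (simp add: X_def)
        have "\<kappa> * P \<le> A * (2 * r / (\<kappa> * damping) * s powr (2 * r - 1))"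
        proof -
          have "s powr (\<kappa> - 2 * r) \<le> t0 powr (\<kappa> - 2 * r)"
            using s t0 False by (intro powr_mono2') auto
          then have "s powr (\<kappa> - 2 * r) * s powr (2 * r - 1) \<le> t0 powr (\<kappa> - 2 * r) * s powr (2 * r - 1)"
            by (intro mult_right_mono) auto
          then have "P \<le> t0 powr (\<kappa> - 2 * r) * s powr (2 * r - 1)"
            by (simp add: P_def powr_add[symmetric])
          then have "\<kappa> * P \<le> \<kappa> * (t0 powr (\<kappa> - 2 * r) * s powr (2 * r - 1))"
            using \<kappa> by (intro mult_left_mono) auto
          also have "\<dots> = A * (2 * r / (\<kappa> * damping) * s powr (2 * r - 1))"
            using r \<kappa> damping_pos by (simp add: A_def power2_eq_square)
          finally show ?thesis .
        qed
        then have "\<kappa> * P * gap (X s) \<le> A * (2 * r / (\<kappa> * damping) * s powr (2 * r - 1)) * gap (X s)"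
          using gX by (rule mult_right_mono)
        then have f1: "A * - (gap (X s) * (2 * r / (\<kappa> * damping) * s powr (2 * r - 1))) \<le> - (\<kappa> * P * gap (X s))"
          by (simp add: mult_ac)
        have f2: "D * ((\<kappa> - 2) * s powr (\<kappa> - 2 - 1)) = - (\<kappa> * P * (C / s\<^sup>2))"
        proof -
          have "D * (\<kappa> - 2) = - (\<kappa> * C)" using \<kappa>2 by (simp add: D_def field_simps)
          then have "D * (\<kappa> - 2) * (P / s\<^sup>2) = - (\<kappa> * C) * (P / s\<^sup>2)" by (simp only:)
          then show ?thesis unfolding P by (simp add: mult_ac)
        qed
        have "upper_slope_le (\<lambda>s. A * - tikhonov_value (eps s) + D * s powr (\<kappa> - 2)) s
            (- (\<kappa> * P * (gap (X s) + C / s\<^sup>2)))"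
          by (rule upper_slope_le_mono[OF upper_slope_le_add[OF e1 e2]])
            (use f1 f2 in \<open>simp add: distrib_left\<close>)
        then show ?thesis by (simp add: Y_def P_def)
      qed
    qed auto
    define E where "E = max 0 (K + A * ((norm xmin)\<^sup>2 / 2))"
    show thesis
    proof (rule that[OF K(1)])
      fix t assume t: "t0 \<le> t"
      have t0': "0 < t" using t t0 by simp
      have "0 \<le> D * t powr (\<kappa> - 2)" using D0 by simp
      moreover have "A * tikhonov_value (eps t) \<le> A * ((norm xmin)\<^sup>2 / 2)"
        using A0 by (intro mult_left_mono tikhonov_value_le eps_pos t0' less_imp_le)
      ultimately have "K + Y t \<le> E" by (simp add: Y_def E_def)
      then have "(K + Y t) / t powr \<kappa> \<le> E / t powr \<kappa>" by (intro divide_right_mono) auto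
      also have "\<dots> \<le> E * (1 / t powr \<kappa> + 1 / t powr (2 * r))"
        by (simp add: distrib_left E_def)
      finally show "gap (x t) \<le> E * (1 / t powr \<kappa> + 1 / t powr (2 * r))"
        using K(2)[OF t] by linarith
    qed
  qed
qed

end

theorem theorem9:
  fixes f :: "'a::{real_inner, complete_space} \<Rightarrow> ereal"
    and x :: "real \<Rightarrow> 'a" and x0 xstar :: 'a and r \<alpha> t0 :: real
  assumes "convex_fun f" and "lower_semicontinuous f" and "proper_fun f"
    and "argmin_set f \<noteq> {}"
    and "is_arg_min norm (\<lambda>y. y \<in> argmin_set f) xstar"
    and "0 < r" and "r < 1" and "1 < \<alpha>" and "0 < t0"
    and "x0 \<in> effective_domain f"
    and "generalized_solution f r \<alpha> t0 x0 x"
  shows "(\<exists>C. \<forall>\<^sub>F t in at_top.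
            \<bar>f (x t) - (INF y. f y)\<bar> \<le> ereal (C * (1 / t powr (\<alpha> - 1) + 1 / t powr (2 * r))))
         \<and> (x \<longlongrightarrow> xstar) at_top"
proof -
  obtain v where v: "strong_solution f r \<alpha> t0 v x" "v t0 = x0" "x t0 = x0"
    using assms(11) by (auto simp: generalized_solution_def)
  interpret trajectory f xstar r "\<alpha> - 1" t0 x0 v x
    using assms v by unfold_locales auto
  obtain C where C: "\<And>t. t0 \<le> t \<Longrightarrow> x t \<in> effective_domain f"
    "\<And>t. t0 \<le> t \<Longrightarrow> gap (x t) \<le> C * (1 / t powr (\<alpha> - 1) + 1 / t powr (2 * r))"
    using gap_x_rate by auto
  have "(INF y. f y) = f xstar"
    using f_min_le by (intro antisym INF_lower INF_greatest) auto
  then have inf: "(INF y. f y) = ereal (real_of_ereal (f xstar))"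
    using f_eq_ereal[OF min_in_dom] by simp
  have "\<bar>f (x t) - (INF y. f y)\<bar> \<le> ereal (C * (1 / t powr (\<alpha> - 1) + 1 / t powr (2 * r)))"
    if t: "t0 \<le> t" for t
    using f_eq_gap[OF C(1)[OF t]] gap_nonneg[OF C(1)[OF t]] C(2)[OF t] inf by simp
  then have "\<forall>\<^sub>F t in at_top. \<bar>f (x t) - (INF y. f y)\<bar>
      \<le> ereal (C * (1 / t powr (\<alpha> - 1) + 1 / t powr (2 * r)))"
    by (auto simp: eventually_at_top_linorder)
  then show ?thesis using x_tendsto by blast
qed

end
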